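(* To the set $\{A\in\mathrm{Mat}(n,\mathbb R)\mid\det A\neq 0\}$ of non-singular $n\times n$ real matrices there corresponds a unique $G_{0n}$-orbit of solutions of the classical Yang--Baxter equation of type $\varphi_F$: namely, all the solutions $\varphi_F$ obtained from $n$-tuples $F=(F^1,\dots,F^n)$ of formal power series of the form $$F^i(u)=a_{i1}u^1+a_{i2}u^2+\cdots+a_{in}u^n+\sum_{|\mathbf k|>1}f^i_{\mathbf k}\,\mathbf u^{\mathbf k},\qquad i=1,\dots,n,$$ where $A=(a_{ij})$ ranges over all non-singular real $n\times n$ matrices and the $f^i_{\mathbf k}\in\mathbb R$ are arbitrary, lie on one and the same $G_{0n}$-orbit. Moreover, there is a canonical triangular $r$-matrix $\tilde\varphi^{ij}(u,v)\in\mathbb R[u,v]$ (with polynomial entries) representing this $G_{0n}$-orbit, namely the one obtained from $F^i(u)=u^i$, $i=1,\dots,n$.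
   Context: For $\mathbf k=(k_1,\dots,k_n)\in\mathbb Z_+^n$ (non-negative integers), $|\mathbf k|=k_1+\cdots+k_n$ and $\mathbf u^{\mathbf k}=(u^1)^{k_1}\cdots(u^n)^{k_n}$. $G_{0n}=FDiff_0(\mathbb R^n)$ is the group, under composition, of formal diffeomorphisms of $\mathbb R^n$ fixing $0$: $n$-tuples $X=(X^1,\dots,X^n)$ of formal power series in $u=(u^1,\dots,u^n)$ without constant term and with invertible linear part. A solution of the classical Yang--Baxter equation (CYBE) for $W_n$ (a triangular $r$-matrix) is a family $\varphi^{ij}(u,v)$, $i,j=1,\dots,n$, with $\varphi^{ij}(u,v)=-\varphi^{ji}(v,u)$ such that for all $i,j,k$, with summation over the repeated index $s=1,\dots,n$ understood, $$\begin{aligned}&\varphi^{ks}(w,u)\frac{\partial \varphi^{ij}(u,v)}{\partial u^s}+\varphi^{sk}(v,w)\frac{\partial \varphi^{ji}(v,u)}{\partial v^s}+\varphi^{is}(u,v)\frac{\partial \varphi^{jk}(v,w)}{\partial v^s}\\&+\varphi^{si}(w,u)\frac{\partial \varphi^{kj}(w,v)}{\partial w^s}+\varphi^{js}(v,w)\frac{\partial \varphi^{ki}(w,u)}{\partial w^s}+\varphi^{sj}(u,v)\frac{\partial \varphi^{ik}(u,w)}{\partial u^s}=0.\end{aligned}$$ For $F^1,\dots,F^n$ with invertible Jacobian matrix $F_{*u}=(\partial F^i/\partial u^j)$, the solution of type $\varphi_F$ obtained from $F$ is $$\varphi_F^{ij}(u,v)=\sum_{k,l=1}^{n}\left(F_{*u}^{-1}\right)^{i}_{k}\left(F_{*v}^{-1}\right)^{j}_{l}\left[F^{k}(u)-F^{l}(v)\right].$$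 The group $G_{0n}$ acts on solutions of the CYBE by push-forward of bivector fields: $X\cdot\varphi=\tilde\varphi$ where $\tilde\varphi^{ij}(X(u),X(v))=\sum_{k,l}(X_{*u})^i_k(X_{*v})^j_l\,\varphi^{kl}(u,v)$, with $X_{*u}$ the Jacobian matrix of $X$ at $u$. *)

theory Defs
  imports "HOL-Analysis.Determinants" "HOL-Algebra.Group_Action" "HOL-Library.Poly_Mapping"
begin

section \<open>Formal power series in finitely many variables over the reals\<close>

text \<open>
  The variables are the elements of a finite type \<open>'v\<close>; a multi-index is a finitely supported
  function \<open>k :: 'v \<Rightarrow>\<^sub>0 nat\<close>, and a power series is its family of coefficients.
\<close>

typedef 'v mps = "UNIV :: (('v \<Rightarrow>\<^sub>0 nat) \<Rightarrow> real) set"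
  morphisms mps_coeff Abs_mps
  by simp

lemma mps_coeff_Abs [simp]: "mps_coeff (Abs_mps f) = f"
  by (simp add: Abs_mps_inverse)

lemma mps_eq_iff: "f = g \<longleftrightarrow> (\<forall>k. mps_coeff f k = mps_coeff g k)"
  by (metis ext mps_coeff_inject)

definition mdeg :: "('v::finite \<Rightarrow>\<^sub>0 nat) \<Rightarrow> nat" where
  "mdeg k = (\<Sum>i\<in>UNIV. Poly_Mapping.lookup k i)"

instantiation mps :: (type) zero
begin
definition "0 = Abs_mps (\<lambda>_. 0)"
instance ..
end

instantiation mps :: (type) one
begin
definition "1 = Abs_mps (\<lambda>k. if k = 0 then 1 else 0)"
instance ..
end

instantiation mps :: (type) plus
begin
definition "f + g = Abs_mps (\<lambda>k. mps_coeff f k + mps_coeff g k)"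
instance ..
end

instantiation mps :: (type) uminus
begin
definition "- f = Abs_mps (\<lambda>k. - mps_coeff f k)"
instance ..
end

instantiation mps :: (type) minus
begin
definition "f - g = Abs_mps (\<lambda>k. mps_coeff f k - mps_coeff g k)"
instance ..
end

instantiation mps :: (type) times
begin
definition "f * g = Abs_mps (\<lambda>k. \<Sum>(a, b)\<in>{(a, b). a + b = k}. mps_coeff f a * mps_coeff g b)"
instance ..
end

lemma mps_coeff_simps [simp]:
  "mps_coeff 0 k = 0"
  "mps_coeff 1 k = (if k = 0 then 1 else 0)"
  "mps_coeff (f + g) k = mps_coeff f k + mps_coeff g k"
  "mps_coeff (- f) k = - mps_coeff f k"
  "mps_coeff (f - g) k = mps_coeff f k - mps_coeff g k"
  by (simp_all add: zero_mps_def one_mps_def plus_mps_def uminus_mps_def minus_mps_def)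

lemma mps_coeff_mult:
  "mps_coeff (f * g) k = (\<Sum>(a, b)\<in>{(a, b). a + b = k}. mps_coeff f a * mps_coeff g b)"
  by (simp add: times_mps_def)

lemma finite_multi_index_decompositions:
  fixes k :: "'v::finite \<Rightarrow>\<^sub>0 nat"
  shows "finite {(a, b). a + b = k}"
proof -
  let ?S = "{a. \<exists>b. a + b = k}"
  have "Poly_Mapping.lookup ` ?S \<subseteq> PiE UNIV (\<lambda>i. {..Poly_Mapping.lookup k i})"
    by (auto simp: lookup_add)
  then have "finite (Poly_Mapping.lookup ` ?S)"
    by (rule finite_subset) (simp add: finite_PiE)
  then have "finite ?S"
    by (rule finite_imageD) (simp add: inj_on_def lookup_inject)
  moreover have "{(a, b). a + b = k} \<subseteq> (\<lambda>a. (a, k - a)) ` ?S"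
    by (force simp: image_iff)
  ultimately show ?thesis
    by (meson finite_imageI finite_subset)
qed

instance mps :: (finite) comm_ring_1
proof
  fix f g h :: "'a mps"
  show "f * g = g * f"
    unfolding mps_eq_iff mps_coeff_mult
    by (intro allI sum.reindex_bij_witness[of _ prod.swap prod.swap])
       (auto simp: add.commute mult.commute)
  show "(f + g) * h = f * h + g * h"
    by (simp add: mps_eq_iff mps_coeff_mult distrib_right case_prod_unfold sum.distrib)
  show "1 * f = f"
    unfolding mps_eq_iff
  proof
    fix k :: "'a \<Rightarrow>\<^sub>0 nat"
    have "mps_coeff (1 * f) k = (\<Sum>p\<in>{(0 :: 'a \<Rightarrow>\<^sub>0 nat, k)}. mps_coeff f (snd p))"
      unfolding mps_coeff_mult
      by (rule sum.mono_neutral_cong_right[OF finite_multi_index_decompositions]) (auto split: if_splits)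
    then show "mps_coeff (1 * f) k = mps_coeff f k" by simp
  qed
  show "f * g * h = f * (g * h)"
    unfolding mps_eq_iff
  proof
    fix k :: "'a \<Rightarrow>\<^sub>0 nat"
    let ?D = "\<lambda>k :: 'a \<Rightarrow>\<^sub>0 nat. {(a, b). a + b = k}"
    have fin: "\<And>k. finite (?D k)" by (rule finite_multi_index_decompositions)
    have "mps_coeff (f * g * h) k =
      (\<Sum>p\<in>?D k. \<Sum>q\<in>?D (fst p). mps_coeff f (fst q) * mps_coeff g (snd q) * mps_coeff h (snd p))"
      by (simp add: mps_coeff_mult case_prod_unfold sum_distrib_right)
    also have "\<dots> = (\<Sum>(p, q)\<in>Sigma (?D k) (\<lambda>p. ?D (fst p)).
        mps_coeff f (fst q) * mps_coeff g (snd q) * mps_coeff h (snd p))"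
      by (rule sum.Sigma) (auto simp: fin)
    also have "\<dots> = (\<Sum>(p, q)\<in>Sigma (?D k) (\<lambda>p. ?D (snd p)).
        mps_coeff f (fst p) * mps_coeff g (fst q) * mps_coeff h (snd q))"
      by (rule sum.reindex_bij_witness[of _ "\<lambda>((a, r), (b, c)). ((a + b, c), (a, b))"
            "\<lambda>((r, c), (a, b)). ((a, b + c), (b, c))"]) (auto simp: add.assoc)
    also have "\<dots> = (\<Sum>p\<in>?D k. \<Sum>q\<in>?D (snd p).
        mps_coeff f (fst p) * mps_coeff g (fst q) * mps_coeff h (snd q))"
      by (rule sum.Sigma[symmetric]) (auto simp: fin)
    also have "\<dots> = mps_coeff (f * (g * h)) k"
      by (simp add: mps_coeff_mult case_prod_unfold sum_distrib_left mult.assoc)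
    finally show "mps_coeff (f * g * h) k = mps_coeff (f * (g * h)) k" .
  qed
  show "(0 :: 'a mps) \<noteq> 1"
    by (auto simp: mps_eq_iff)
qed (simp_all add: mps_eq_iff)

definition mps_const :: "real \<Rightarrow> 'v mps" where
  "mps_const c = Abs_mps (\<lambda>k. if k = 0 then c else 0)"

definition mps_var :: "'v \<Rightarrow> 'v mps" where
  "mps_var i = Abs_mps (\<lambda>k. if k = Poly_Mapping.single i 1 then 1 else 0)"

definition mps_deriv :: "'v \<Rightarrow> 'v mps \<Rightarrow> 'v mps" where
  "mps_deriv i f = Abs_mps (\<lambda>k. of_nat (Poly_Mapping.lookup k i + 1) *
     mps_coeff f (k + Poly_Mapping.single i 1))"

definition mps_polynomial :: "'v mps \<Rightarrow> bool" where
  "mps_polynomial f \<longleftrightarrow> finite {k. mps_coeff f k \<noteq> 0}"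

text \<open>
  Substitution \<open>f(X)\<close>. It is only meaningful when the series \<open>X $ i\<close> have no constant term: then
  \<open>\<Prod>i. (X $ i) ^ k\<^sub>i\<close> has no terms of degree less than \<open>mdeg k\<close>, so that truncating the
  sum over \<open>k\<close> loses nothing.
\<close>

definition mps_compose :: "'v::finite mps \<Rightarrow> 'w::finite mps ^ 'v \<Rightarrow> 'w mps" where
  "mps_compose f X = Abs_mps (\<lambda>m. \<Sum>k\<in>{k. mdeg k \<le> mdeg m}.
     mps_coeff f k * mps_coeff (\<Prod>i\<in>UNIV. (X $ i) ^ Poly_Mapping.lookup k i) m)"


section \<open>The group of formal diffeomorphisms fixing the origin\<close>

definition mps_jacobian :: "'n mps ^ 'n \<Rightarrow> 'n mps ^ 'n ^ 'n" where
  "mps_jacobian F = (\<chi> i j. mps_deriv j (F $ i))"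

definition linear_part :: "'n mps ^ 'n \<Rightarrow> real ^ 'n ^ 'n" where
  "linear_part F = (\<chi> i j. mps_coeff (F $ i) (Poly_Mapping.single j 1))"

definition FDiff0 :: "('n::finite mps ^ 'n) monoid" where
  "FDiff0 = \<lparr>carrier = {X. (\<forall>i. mps_coeff (X $ i) 0 = 0) \<and> invertible (linear_part X)},
     monoid.mult = (\<lambda>X Y. \<chi> i. mps_compose (X $ i) Y),
     one = (\<chi> i. mps_var i)\<rparr>"


section \<open>Solutions of the classical Yang--Baxter equation for \<open>W\<^sub>n\<close>\<close>

text \<open>
  A family \<open>\<phi>\<^sup>i\<^sup>j(u, v)\<close> is a matrix of series in the variables \<open>'n + 'n\<close>, where \<open>Inl i\<close> stands
  for \<open>u\<^sup>i\<close> and \<open>Inr i\<close> for \<open>v\<^sup>i\<close>. \<open>at2 f p q\<close> is \<open>f(p, q)\<close>.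
\<close>

type_synonym 'n bifamily = "('n + 'n) mps ^ 'n ^ 'n"

definition at2 :: "('n::finite + 'n) mps \<Rightarrow> 'w::finite mps ^ 'n \<Rightarrow> 'w mps ^ 'n \<Rightarrow> 'w mps" where
  "at2 f p q = mps_compose f (\<chi> x. case x of Inl i \<Rightarrow> p $ i | Inr i \<Rightarrow> q $ i)"

text \<open>The matrix \<open>M(p)\<close>.\<close>

definition mat_at :: "'n::finite mps ^ 'n ^ 'n \<Rightarrow> 'w::finite mps ^ 'n \<Rightarrow> 'w mps ^ 'n ^ 'n" where
  "mat_at M p = (\<chi> i j. mps_compose (M $ i $ j) p)"

definition var_u :: "('n + 'n) mps ^ 'n" where "var_u = (\<chi> i. mps_var (Inl i))"
definition var_v :: "('n + 'n) mps ^ 'n" where "var_v = (\<chi> i. mps_var (Inr i))"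

text \<open>
  The Yang--Baxter equation lives in the variables \<open>'n + 'n + 'n\<close>, for \<open>(u, v, w)\<close>.
\<close>

definition CYBE_solution :: "'n::finite bifamily \<Rightarrow> bool" where
  "CYBE_solution \<phi> \<longleftrightarrow>
     (\<forall>i j. \<phi> $ i $ j = - at2 (\<phi> $ j $ i) var_v var_u) \<and>
     (let iu = (\<lambda>s. Inl s :: 'n + 'n + 'n); iv = (\<lambda>s. Inr (Inl s)); iw = (\<lambda>s. Inr (Inr s));
          u = (\<chi> i. mps_var (iu i)); v = (\<chi> i. mps_var (iv i)); w = (\<chi> i. mps_var (iw i));
          \<Phi> = (\<lambda>i j p q. at2 (\<phi> $ i $ j) p q)
      in \<forall>i j k. (\<Sum>s\<in>UNIV.
             \<Phi> k s w u * mps_deriv (iu s) (\<Phi> i j u v)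
           + \<Phi> s k v w * mps_deriv (iv s) (\<Phi> j i v u)
           + \<Phi> i s u v * mps_deriv (iv s) (\<Phi> j k v w)
           + \<Phi> s i w u * mps_deriv (iw s) (\<Phi> k j w v)
           + \<Phi> j s v w * mps_deriv (iw s) (\<Phi> k i w u)
           + \<Phi> s j u v * mps_deriv (iu s) (\<Phi> i k u w)) = 0)"

definition phi :: "'n::finite mps ^ 'n \<Rightarrow> 'n bifamily" where
  "phi F = (let P = matrix_inv (mps_jacobian F) in
     \<chi> i j. \<Sum>k\<in>UNIV. \<Sum>l\<in>UNIV. mat_at P var_u $ i $ k * mat_at P var_v $ j $ l *
       (mps_compose (F $ k) var_u - mps_compose (F $ l) var_v))"

definition of_type_phi :: "'n::finite bifamily set" where
  "of_type_phi = {phi F | F. invertible (mps_jacobian F)}"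

text \<open>
  The push-forward \<open>X \<cdot> \<phi>\<close>; for \<open>X\<close> in \<open>FDiff0\<close> the equation has exactly one solution.
\<close>

definition push_forward :: "'n::finite mps ^ 'n \<Rightarrow> 'n bifamily \<Rightarrow> 'n bifamily" where
  "push_forward X \<phi> = (THE \<psi>. \<forall>i j.
     at2 (\<psi> $ i $ j) (\<chi> m. mps_compose (X $ m) var_u) (\<chi> m. mps_compose (X $ m) var_v) =
     (\<Sum>k\<in>UNIV. \<Sum>l\<in>UNIV. mat_at (mps_jacobian X) var_u $ i $ k *
        mat_at (mps_jacobian X) var_v $ j $ l * \<phi> $ k $ l))"

text \<open>
  The \<open>n\<close>-tuple with linear part \<open>A\<close>, no constant term, and the coefficients \<open>f i k\<close> in
  degrees \<open>mdeg k > 1\<close> (the values of \<open>f i\<close> in lower degrees are ignored).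
\<close>

definition series_of :: "real ^ 'n ^ 'n \<Rightarrow> ('n \<Rightarrow> ('n::finite \<Rightarrow>\<^sub>0 nat) \<Rightarrow> real) \<Rightarrow> 'n mps ^ 'n" where
  "series_of A f = (\<chi> i. (\<Sum>j\<in>UNIV. mps_const (A $ i $ j) * mps_var j)
     + Abs_mps (\<lambda>k. if mdeg k > 1 then f i k else 0))"

end

theory Submission
  imports Defs
begin

text \<open>
  Why the theorem holds. Write \<open>J\<close> for the Jacobian matrix of a tuple \<open>F\<close>, and put
  \<open>\<sigma> = J\<^sup>-\<^sup>1 (1, \<dots>, 1)\<close> and \<open>E = J\<^sup>-\<^sup>1 F\<close>; in the coordinates \<open>F\<close> these are the vector fields
  \<open>\<Sum>\<^sub>k \<partial>\<^sub>k\<close> and \<open>\<Sum>\<^sub>k F\<^sup>k \<partial>\<^sub>k\<close>. Expanding the definition gives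
  \<open>\<phi>\<^sub>F(u, v) = E(u) \<otimes> \<sigma>(v) - \<sigma>(u) \<otimes> E(v)\<close> (\<open>phi_eq_wedge\<close>), and \<open>[\<sigma>, E] = \<sigma>\<close>
  (\<open>bracket_translation_euler\<close>), so \<open>\<phi>\<^sub>F\<close> is the triangular r-matrix of a two-dimensional
  non-abelian Lie algebra. Accordingly, the six terms of the Yang--Baxter equation are grouped in
  pairs, by the point at which they are differentiated; each pair involves derivatives through
  \<open>[\<sigma>, E]\<close> only (\<open>CYBE_pair\<close>), and the three resulting expressions cancel cyclically
  (\<open>CYBE_solution_phi\<close>). This needs only that \<open>J\<close> is invertible.

  For \<open>F\<close> in \<open>FDiff0\<close>, push-forward along \<open>F\<close> removes the factors \<open>J\<^sup>-\<^sup>1\<close> and takes \<open>\<phi>\<^sub>F\<close> to the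
  solution \<open>u\<^sup>i - v\<^sup>j\<close> given by the identity tuple (\<open>is_push_phi\<close>). Since push-forward is
  a group action, the orbit of that solution is \<open>{\<phi>\<^sub>F | F \<in> FDiff0}\<close> (\<open>orbit_phi_id\<close>), and the
  tuples with non-singular linear part belong to \<open>FDiff0\<close> (\<open>series_of_in_FDiff0\<close>).

  That push-forward is well defined and an action rests on three facts about formal power series:
  substitution is an associative ring homomorphism, it obeys the chain rule, and \<open>FDiff0\<close> is a
  group. The first two, like the Leibniz rule, say that a certain continuous additive map vanishes,
  which is reduced by \<open>mps_additive_continuous_eq_0\<close> to multiplication by one variable. Inverses
  in \<open>FDiff0\<close> come from a linear problem: if \<open>X\<close> is tangent to the identity, then
  \<open>g \<mapsto> g \<circ> X\<close> differs from the identity map by an operator that raises the order of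
  vanishing (\<open>compose_tangent_to_id\<close>), so it is surjective by successive approximation.
\<close>

section \<open>Order of vanishing and determination by continuity\<close>

lemma mps_eqI: "(\<And>k. mps_coeff f k = mps_coeff g k) \<Longrightarrow> f = g"
  by (simp add: mps_eq_iff)

text \<open>All terms of total degree less than \<open>n\<close> vanish; these ideals form the filtration with respect to
  which series are limits of polynomials.\<close>

definition vanishes_below :: "nat \<Rightarrow> 'v::finite mps \<Rightarrow> bool" where
  "vanishes_below n f \<longleftrightarrow> (\<forall>k. mdeg k < n \<longrightarrow> mps_coeff f k = 0)"

lemma mdeg_simps [simp]:
  "mdeg 0 = 0" "mdeg (a + b) = mdeg a + mdeg b" "mdeg (Poly_Mapping.single i n) = n"
  by (simp_all add: mdeg_def lookup_add sum.distrib lookup_single when_def)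

lemma mdeg_eq_0_iff [simp]: "mdeg k = 0 \<longleftrightarrow> k = 0"
  by (auto simp: mdeg_def intro: poly_mapping_eqI)

lemma single_1_neq_0: "Poly_Mapping.single i (Suc 0) \<noteq> (0 :: 'v::finite \<Rightarrow>\<^sub>0 nat)"
  by (metis mdeg_simps(1,3) nat.distinct(1))

lemma single_1_eq_iff: "Poly_Mapping.single i (Suc 0) = Poly_Mapping.single j (Suc 0) \<longleftrightarrow> i = j"
  by (metis lookup_single_eq lookup_single_not_eq nat.distinct(1))

lemma finite_mdeg_le: "finite {k :: 'v::finite \<Rightarrow>\<^sub>0 nat. mdeg k \<le> N}"
proof -
  have "Poly_Mapping.lookup ` {k :: 'v \<Rightarrow>\<^sub>0 nat. mdeg k \<le> N} \<subseteq> PiE UNIV (\<lambda>i. {..N})"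
  proof (clarsimp simp: PiE_def extensional_def Pi_def)
    fix k :: "'v \<Rightarrow>\<^sub>0 nat" and i assume "mdeg k \<le> N"
    moreover have "Poly_Mapping.lookup k i \<le> mdeg k"
      unfolding mdeg_def by (rule member_le_sum) auto
    ultimately show "Poly_Mapping.lookup k i \<le> N" by simp
  qed
  then have "finite (Poly_Mapping.lookup ` {k :: 'v \<Rightarrow>\<^sub>0 nat. mdeg k \<le> N})"
    by (rule finite_subset) (simp add: finite_PiE)
  then show ?thesis
    by (rule finite_imageD) (simp add: inj_on_def lookup_inject)
qed

lemma vanishes_below_0 [simp]: "vanishes_below 0 f"
  by (simp add: vanishes_below_def)

lemma vanishes_below_1_iff: "vanishes_below (Suc 0) f \<longleftrightarrow> mps_coeff f 0 = 0"
  by (simp add: vanishes_below_def)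

lemma vanishes_below_mono: "vanishes_below n f \<Longrightarrow> m \<le> n \<Longrightarrow> vanishes_below m f"
  by (simp add: vanishes_below_def)

lemma vanishes_below_add: "vanishes_below n f \<Longrightarrow> vanishes_below n g \<Longrightarrow> vanishes_below n (f + g)"
  by (simp add: vanishes_below_def)

lemma vanishes_below_uminus: "vanishes_below n f \<Longrightarrow> vanishes_below n (- f)"
  by (simp add: vanishes_below_def)

lemma vanishes_below_diff: "vanishes_below n f \<Longrightarrow> vanishes_below n g \<Longrightarrow> vanishes_below n (f - g)"
  by (simp add: vanishes_below_def)

lemma mps_coeff_sum: "mps_coeff (sum f A) k = (\<Sum>a\<in>A. mps_coeff (f a) k)"
  by (induction A rule: infinite_finite_induct) auto

lemma vanishes_below_sum: "(\<And>a. a \<in> A \<Longrightarrow> vanishes_below n (f a)) \<Longrightarrow> vanishes_below n (sum f A)"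
  by (simp add: vanishes_below_def mps_coeff_sum)

lemma vanishes_below_mult:
  assumes "vanishes_below m f" "vanishes_below n g"
  shows "vanishes_below (m + n) (f * g)"
  unfolding vanishes_below_def mps_coeff_mult
proof (intro allI impI sum.neutral ballI)
  fix k :: "'a \<Rightarrow>\<^sub>0 nat" and p assume k: "mdeg k < m + n" and "p \<in> {(a, b). a + b = k}"
  then obtain a b where p: "p = (a, b)" "k = a + b" by auto
  with k have "mdeg a < m \<or> mdeg b < n" by auto
  with assms show "(case p of (a, b) \<Rightarrow> mps_coeff f a * mps_coeff g b) = 0"
    by (auto simp: p vanishes_below_def)
qed

lemma vanishes_below_mult_left: "vanishes_below n g \<Longrightarrow> vanishes_below n (f * g)"
  using vanishes_below_mult[of 0 f n g] by simp

lemma vanishes_below_mult_right: "vanishes_below n f \<Longrightarrow> vanishes_below n (f * g)"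
  using vanishes_below_mult[of n f 0 g] by simp

lemma vanishes_below_prod:
  "(\<And>a. a \<in> A \<Longrightarrow> vanishes_below (d a) (f a)) \<Longrightarrow> vanishes_below (sum d A) (prod f A)"
  by (induction A rule: infinite_finite_induct) (auto intro: vanishes_below_mult)

lemma vanishes_below_power:
  assumes "vanishes_below 1 f" shows "vanishes_below n (f ^ n)"
  by (induction n) (use vanishes_below_mult[OF assms] in auto)

lemma mps_eqI_vanishes:
  assumes "\<And>n. vanishes_below n (f - g)"
  shows "f = g"
proof (rule mps_eqI)
  fix k show "mps_coeff f k = mps_coeff g k"
    using assms[of "Suc (mdeg k)"] by (auto simp: vanishes_below_def)
qed

lemma mps_coeff_var: "mps_coeff (mps_var i) k = (if k = Poly_Mapping.single i 1 then 1 else 0)"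
  by (simp add: mps_var_def)

lemma mps_coeff_const: "mps_coeff (mps_const c) k = (if k = 0 then c else 0)"
  by (simp add: mps_const_def)

lemma multi_index_split:
  fixes k :: "'v::finite \<Rightarrow>\<^sub>0 nat"
  assumes "0 < Poly_Mapping.lookup k i"
  shows "Poly_Mapping.single i 1 + (k - Poly_Mapping.single i 1) = k"
  using assms by (intro poly_mapping_eqI) (auto simp: lookup_add lookup_minus lookup_single when_def)

lemma mps_coeff_var_mult:
  fixes f :: "'v::finite mps"
  shows "mps_coeff (mps_var i * f) k =
    (if Poly_Mapping.lookup k i > 0 then mps_coeff f (k - Poly_Mapping.single i 1) else 0)"
proof (cases "Poly_Mapping.lookup k i > 0")
  case True
  have "mps_coeff (mps_var i * f) k =
    (\<Sum>p\<in>{(Poly_Mapping.single i 1 :: 'v \<Rightarrow>\<^sub>0 nat, k - Poly_Mapping.single i 1)}. mps_coeff f (snd p))"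
    unfolding mps_coeff_mult
  proof (rule sum.mono_neutral_cong_right[OF finite_multi_index_decompositions])
    show "{(Poly_Mapping.single i 1, k - Poly_Mapping.single i 1)} \<subseteq> {(a, b). a + b = k}"
      using multi_index_split[OF True] by simp
  qed (auto simp: mps_coeff_var split: if_splits)
  with True show ?thesis by simp
next
  case False
  have "mps_coeff (mps_var i * f) k = 0"
    unfolding mps_coeff_mult
  proof (intro sum.neutral ballI)
    fix p assume "p \<in> {(a, b). a + b = k}"
    with False have "fst p \<noteq> Poly_Mapping.single i 1"
      by (auto simp: lookup_add)
    then show "(case p of (a, b) \<Rightarrow> mps_coeff (mps_var i) a * mps_coeff f b) = 0"
      by (auto simp: mps_coeff_var split: prod.split)
  qed
  with False show ?thesis by simp
qed

lemma mps_coeff_const_mult: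
  fixes f :: "'v::finite mps"
  shows "mps_coeff (mps_const c * f) k = c * mps_coeff f k"
proof -
  have "mps_coeff (mps_const c * f) k = (\<Sum>p\<in>{(0 :: 'v \<Rightarrow>\<^sub>0 nat, k)}. c * mps_coeff f (snd p))"
    unfolding mps_coeff_mult
    by (rule sum.mono_neutral_cong_right[OF finite_multi_index_decompositions])
       (auto simp: mps_coeff_const split: if_splits)
  then show ?thesis by simp
qed

text \<open>The monomial with coefficient \<open>c\<close> and exponent \<open>k\<close>.\<close>

definition mps_monom :: "('v \<Rightarrow>\<^sub>0 nat) \<Rightarrow> real \<Rightarrow> 'v mps" where
  "mps_monom k c = Abs_mps (\<lambda>m. if m = k then c else 0)"

lemma mps_coeff_monom: "mps_coeff (mps_monom k c) m = (if m = k then c else 0)"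
  by (simp add: mps_monom_def)

lemma mps_monom_0: "mps_monom 0 c = mps_const c"
  by (simp add: mps_monom_def mps_const_def)

lemma mps_monom_add_single:
  fixes k :: "'v::finite \<Rightarrow>\<^sub>0 nat"
  shows "mps_monom (Poly_Mapping.single i 1 + k) c = mps_var i * mps_monom k c"
proof (rule mps_eqI)
  fix m
  show "mps_coeff (mps_monom (Poly_Mapping.single i 1 + k) c) m = mps_coeff (mps_var i * mps_monom k c) m"
    using multi_index_split[of m i]
    by (auto simp: mps_coeff_var_mult mps_coeff_monom lookup_add)
qed

lemma multi_index_induct [case_names zero add_single]:
  fixes k :: "'v::finite \<Rightarrow>\<^sub>0 nat"
  assumes "P 0" and "\<And>i k. P k \<Longrightarrow> P (Poly_Mapping.single i 1 + k)"
  shows "P k"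
proof (induction "mdeg k" arbitrary: k)
  case 0
  then show ?case using assms(1) by simp
next
  case (Suc d)
  then have "k \<noteq> 0" by auto
  then obtain i where i: "Poly_Mapping.lookup k i > 0"
    by (metis lookup_zero neq0_conv poly_mapping_eqI)
  let ?k = "k - Poly_Mapping.single i 1"
  have split: "Poly_Mapping.single i 1 + ?k = k" by (rule multi_index_split[OF i])
  then have "mdeg k = Suc (mdeg ?k)" by (metis mdeg_simps(2,3) plus_1_eq_Suc)
  with Suc.hyps have "P ?k" by simp
  from assms(2)[OF this, of i] show ?case by (simp only: split)
qed

text \<open>An additive map that is continuous for the filtration by order of vanishing (losing at most one
  order) is determined by its values on constants and its behaviour under multiplication by a variable.
  The ring homomorphism property of substitution, its associativity, the Leibniz rule and the chain
  rule all say that some such map is zero.\<close>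

lemma mps_additive_continuous_eq_0:
  fixes D :: "'v::finite mps \<Rightarrow> 'w::finite mps"
  assumes add: "\<And>f g. D (f + g) = D f + D g"
    and cont: "\<And>n f. vanishes_below (Suc n) f \<Longrightarrow> vanishes_below n (D f)"
    and const: "\<And>c. D (mps_const c) = 0"
    and var: "\<And>i f. D f = 0 \<Longrightarrow> D (mps_var i * f) = 0"
  shows "D f = 0"
proof (rule mps_eqI_vanishes)
  fix n
  \<comment> \<open>Up to order \<open>n\<close> the series is a sum of monomials, on which \<open>D\<close> vanishes.\<close>
  let ?K = "{k :: 'v \<Rightarrow>\<^sub>0 nat. mdeg k \<le> n}"
  define r where "r = f - (\<Sum>k\<in>?K. mps_monom k (mps_coeff f k))"
  have D0: "D 0 = 0"
    using add[of 0 0] by simp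
  have monom: "D (mps_monom k c) = 0" for k c
    by (induction k rule: multi_index_induct) (simp_all only: mps_monom_0 const mps_monom_add_single var)
  have "D (\<Sum>k\<in>A. mps_monom k (mps_coeff f k)) = 0" for A
    by (induction A rule: infinite_finite_induct) (simp_all add: D0 add monom)
  then have "D f = D r"
    using add[of r "\<Sum>k\<in>?K. mps_monom k (mps_coeff f k)"] by (simp add: r_def)
  moreover have "vanishes_below (Suc n) r"
    by (auto simp: vanishes_below_def r_def mps_coeff_sum mps_coeff_monom sum.delta'[OF finite_mdeg_le])
  ultimately show "vanishes_below n (D f - 0)"
    using cont by simp
qed


section \<open>Substitution\<close>

text \<open>The tuples that may be substituted into a series.\<close>

definition no_const :: "'w mps ^ 'v \<Rightarrow> bool" where
  "no_const X \<longleftrightarrow> (\<forall>i. mps_coeff (X $ i) 0 = 0)"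

lemma no_constD: "no_const X \<Longrightarrow> vanishes_below 1 (X $ i)"
  by (simp add: no_const_def vanishes_below_1_iff)

text \<open>The monomial \<open>X\<^sup>k\<close> in the entries of \<open>X\<close>.\<close>

abbreviation mps_power :: "'w::finite mps ^ 'v::finite \<Rightarrow> ('v \<Rightarrow>\<^sub>0 nat) \<Rightarrow> 'w mps" where
  "mps_power X k \<equiv> (\<Prod>i\<in>UNIV. (X $ i) ^ Poly_Mapping.lookup k i)"

lemma vanishes_below_mps_power:
  assumes "no_const X" shows "vanishes_below (mdeg k) (mps_power X k)"
  unfolding mdeg_def by (intro vanishes_below_prod vanishes_below_power no_constD assms)

lemma mps_power_add_single:
  "mps_power X (Poly_Mapping.single i 1 + k) = X $ i * mps_power X k"
  proof -
  have "(X $ j) ^ Poly_Mapping.lookup (Poly_Mapping.single i 1) j = (if i = j then X $ j else 1)" for j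
    by (simp add: lookup_single when_def)
  then show ?thesis
    by (simp add: lookup_add power_add prod.distrib)
qed

text \<open>The truncation bound in the definition of substitution may be raised; hence a single finite sum
  represents \<open>f(X)\<close> in all degrees up to \<open>N\<close>.\<close>

lemma mps_coeff_compose:
  assumes X: "no_const X" and N: "mdeg m \<le> N"
  shows "mps_coeff (mps_compose f X) m =
    mps_coeff (\<Sum>k\<in>{k. mdeg k \<le> N}. mps_const (mps_coeff f k) * mps_power X k) m"
proof -
  have "mps_coeff (mps_compose f X) m =
      (\<Sum>k\<in>{k. mdeg k \<le> mdeg m}. mps_coeff f k * mps_coeff (mps_power X k) m)"
    by (simp add: mps_compose_def)
  also have "\<dots> = (\<Sum>k\<in>{k. mdeg k \<le> N}. mps_coeff f k * mps_coeff (mps_power X k) m)"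
    using N vanishes_below_mps_power[OF X]
    by (intro sum.mono_neutral_left finite_mdeg_le) (auto simp: vanishes_below_def)
  finally show ?thesis
    by (simp add: mps_coeff_sum mps_coeff_const_mult)
qed

lemma mps_compose_truncate:
  assumes "no_const X"
  shows "vanishes_below (Suc N)
    (mps_compose f X - (\<Sum>k\<in>{k. mdeg k \<le> N}. mps_const (mps_coeff f k) * mps_power X k))"
  by (simp add: vanishes_below_def mps_coeff_compose[OF assms])

lemma mps_compose_add: "mps_compose (f + g) X = mps_compose f X + mps_compose g X"
  by (rule mps_eqI) (simp add: mps_compose_def distrib_right sum.distrib)

lemma mps_compose_diff: "mps_compose (f - g) X = mps_compose f X - mps_compose g X"
  by (rule mps_eqI) (simp add: mps_compose_def left_diff_distrib sum_subtractf)

lemma mps_compose_0 [simp]: "mps_compose 0 X = 0"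
  by (rule mps_eqI) (simp add: mps_compose_def)

lemma mps_compose_sum: "mps_compose (sum f A) X = (\<Sum>a\<in>A. mps_compose (f a) X)"
  by (induction A rule: infinite_finite_induct) (simp_all add: mps_compose_add)

lemma mps_compose_const [simp]:
  fixes X :: "'w::finite mps ^ 'v::finite"
  shows "mps_compose (mps_const c) X = mps_const c"
proof (rule mps_eqI)
  fix m
  have "mps_coeff (mps_compose (mps_const c) X) m =
      (\<Sum>k\<in>{k :: 'v \<Rightarrow>\<^sub>0 nat. mdeg k \<le> mdeg m}. if k = 0 then c * mps_coeff (1 :: 'w mps) m else 0)"
    unfolding mps_compose_def mps_coeff_Abs by (intro sum.cong) (auto simp: mps_coeff_const)
  then show "mps_coeff (mps_compose (mps_const c) X) m = mps_coeff (mps_const c) m"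
    by (simp add: mps_coeff_const sum.delta[OF finite_mdeg_le])
qed

lemma mps_const_1: "mps_const 1 = 1"
  by (simp add: mps_const_def one_mps_def)

lemma mps_compose_1 [simp]: "mps_compose 1 X = 1"
  by (metis mps_compose_const mps_const_1)

lemma vanishes_below_compose:
  fixes X :: "'w::finite mps ^ 'v::finite"
  assumes "no_const X" "vanishes_below n f"
  shows "vanishes_below n (mps_compose f X)"
  unfolding vanishes_below_def
proof (intro allI impI)
  fix m :: "'w \<Rightarrow>\<^sub>0 nat" assume "mdeg m < n"
  then show "mps_coeff (mps_compose f X) m = 0"
    using assms by (simp add: mps_compose_def vanishes_below_def)
qed

lemma mps_compose_var_mult:
  fixes f :: "'v::finite mps" and X :: "'w::finite mps ^ 'v"
  assumes X: "no_const X"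
  shows "mps_compose (mps_var i * f) X = X $ i * mps_compose f X"
proof (rule mps_eqI_vanishes)
  fix n
  let ?e = "Poly_Mapping.single i 1"
  let ?T = "\<lambda>N f. \<Sum>k\<in>{k :: 'v \<Rightarrow>\<^sub>0 nat. mdeg k \<le> N}. mps_const (mps_coeff f k) * mps_power X k"
  have "?T (Suc n) (mps_var i * f) =
      (\<Sum>k\<in>{k. mdeg k \<le> Suc n \<and> 0 < Poly_Mapping.lookup k i}.
        mps_const (mps_coeff f (k - ?e)) * mps_power X k)"
    by (rule sum.mono_neutral_cong_right[OF finite_mdeg_le])
       (auto simp: mps_coeff_var_mult mps_const_def simp flip: zero_mps_def)
  \<comment> \<open>Multiplication by the variable shifts exponents by \<open>?e\<close>, hence the two different bounds.\<close>
  also have "\<dots> = (\<Sum>k\<in>{k. mdeg k \<le> n}. mps_const (mps_coeff f k) * mps_power X (?e + k))"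
  proof (rule sum.reindex_bij_witness[of _ "\<lambda>k. ?e + k" "\<lambda>k. k - ?e"])
    fix k :: "'v \<Rightarrow>\<^sub>0 nat" assume "k \<in> {k. mdeg k \<le> Suc n \<and> 0 < Poly_Mapping.lookup k i}"
    then have k: "mdeg k \<le> Suc n" "?e + (k - ?e) = k" using multi_index_split by auto
    have "mdeg k = Suc (mdeg (k - ?e))"
      by (metis k(2) mdeg_simps(2,3) plus_1_eq_Suc)
    with k show "k - ?e \<in> {k. mdeg k \<le> n}" "?e + (k - ?e) = k"
      "mps_const (mps_coeff f (k - ?e)) * mps_power X (?e + (k - ?e)) =
        mps_const (mps_coeff f (k - ?e)) * mps_power X k"
      by simp_all
  qed (auto simp: lookup_add)
  also have "\<dots> = X $ i * ?T n f"
    unfolding mps_power_add_single by (simp add: sum_distrib_left mult.left_commute)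
  finally have eq: "?T (Suc n) (mps_var i * f) = X $ i * ?T n f" .
  have "mps_compose (mps_var i * f) X - X $ i * mps_compose f X =
      (mps_compose (mps_var i * f) X - ?T (Suc n) (mps_var i * f))
      - X $ i * (mps_compose f X - ?T n f)"
    unfolding eq by (simp add: right_diff_distrib)
  moreover have "vanishes_below n (mps_compose (mps_var i * f) X - ?T (Suc n) (mps_var i * f))"
    by (rule vanishes_below_mono[OF mps_compose_truncate[OF X]]) simp
  moreover have "vanishes_below n (X $ i * (mps_compose f X - ?T n f))"
    by (intro vanishes_below_mult_left vanishes_below_mono[OF mps_compose_truncate[OF X]]) simp
  ultimately show "vanishes_below n (mps_compose (mps_var i * f) X - X $ i * mps_compose f X)"
    by (simp only: vanishes_below_diff)
qed

lemma mps_compose_var: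
  assumes "no_const X" shows "mps_compose (mps_var i) X = X $ i"
  using mps_compose_var_mult[OF assms, of i 1] by simp

lemma mps_compose_const_mult: "mps_compose (mps_const c * f) X = mps_const c * mps_compose f X"
  by (rule mps_eqI) (simp add: mps_compose_def mps_coeff_const_mult sum_distrib_left mult.assoc)

lemma mps_compose_mult:
  assumes X: "no_const X"
  shows "mps_compose (f * g) X = mps_compose f X * mps_compose g X"
proof -
  define D where "D f = mps_compose (f * g) X - mps_compose f X * mps_compose g X" for f
  have "D f = 0"
  proof (rule mps_additive_continuous_eq_0[where D = D])
    show "D (f1 + f2) = D f1 + D f2" for f1 f2
      by (simp add: D_def mps_compose_add algebra_simps)
    show "vanishes_below n (D h)" if "vanishes_below (Suc n) h" for n h
    proof -
      have h: "vanishes_below n h" using that by (rule vanishes_below_mono) simp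
      show ?thesis unfolding D_def
        by (intro vanishes_below_diff vanishes_below_mult_right vanishes_below_compose X h)
    qed
    show "D (mps_const c) = 0" for c
      by (simp add: D_def mps_compose_const_mult)
    show "D (mps_var i * h) = 0" if "D h = 0" for i h
      using that by (simp add: D_def mps_compose_var_mult[OF X] mult.assoc)
  qed
  then show ?thesis by (simp add: D_def)
qed

lemma no_const_compose: "no_const X \<Longrightarrow> no_const Y \<Longrightarrow> no_const (\<chi> i. mps_compose (X $ i) Y)"
  using vanishes_below_compose[of Y 1] by (simp add: no_const_def vanishes_below_1_iff)

lemma mps_compose_assoc:
  assumes X: "no_const X" and Y: "no_const Y"
  shows "mps_compose (mps_compose f X) Y = mps_compose f (\<chi> i. mps_compose (X $ i) Y)"
proof -
  note XY = no_const_compose[OF X Y]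
  define D where "D f = mps_compose (mps_compose f X) Y - mps_compose f (\<chi> i. mps_compose (X $ i) Y)" for f
  have "D f = 0"
  proof (rule mps_additive_continuous_eq_0[where D = D])
    show "D (f1 + f2) = D f1 + D f2" for f1 f2
      by (simp add: D_def mps_compose_add algebra_simps)
    show "vanishes_below n (D h)" if "vanishes_below (Suc n) h" for n h
      unfolding D_def
      by (intro vanishes_below_diff vanishes_below_compose X Y XY vanishes_below_mono[OF that]) simp_all
    show "D (mps_var i * h) = 0" if "D h = 0" for i h
      using that by (simp add: D_def mps_compose_var_mult[OF X] mps_compose_var_mult[OF XY] mps_compose_mult[OF Y])
  qed (simp add: D_def)
  then show ?thesis by (simp add: D_def)
qed

lemma no_const_var: "no_const (\<chi> i. mps_var (h i :: 'v::finite))"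
  by (simp add: no_const_def mps_coeff_var single_1_neq_0)

lemma mps_compose_id [simp]: "mps_compose f (\<chi> i. mps_var i) = f"
proof -
  note id = no_const_var[of "\<lambda>i. i"]
  define D where "D f = mps_compose f (\<chi> i. mps_var i) - f" for f :: "'a mps"
  have "D f = 0"
  proof (rule mps_additive_continuous_eq_0[where D = D])
    show "D (f1 + f2) = D f1 + D f2" for f1 f2
      by (simp add: D_def mps_compose_add algebra_simps)
    show "vanishes_below n (D h)" if "vanishes_below (Suc n) h" for n h
      unfolding D_def
      by (intro vanishes_below_diff vanishes_below_compose id vanishes_below_mono[OF that]) simp_all
    show "D (mps_var i * h) = 0" if "D h = 0" for i h
      using that by (simp add: D_def mps_compose_var_mult[OF id])
  qed (simp add: D_def)
  then show ?thesis by (simp add: D_def)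
qed


section \<open>Partial derivatives and the chain rule\<close>

lemma mps_coeff_deriv:
  "mps_coeff (mps_deriv i f) k = of_nat (Poly_Mapping.lookup k i + 1) * mps_coeff f (k + Poly_Mapping.single i 1)"
  by (simp add: mps_deriv_def)

lemma mps_deriv_add: "mps_deriv i (f + g) = mps_deriv i f + mps_deriv i g"
  by (rule mps_eqI) (simp add: mps_coeff_deriv algebra_simps)

lemma mps_deriv_diff: "mps_deriv i (f - g) = mps_deriv i f - mps_deriv i g"
  by (rule mps_eqI) (simp add: mps_coeff_deriv algebra_simps)

lemma mps_deriv_0 [simp]: "mps_deriv i 0 = 0"
  by (rule mps_eqI) (simp add: mps_coeff_deriv)

lemma mps_deriv_sum: "mps_deriv i (sum f A) = (\<Sum>a\<in>A. mps_deriv i (f a))"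
  by (induction A rule: infinite_finite_induct) (simp_all add: mps_deriv_add)

lemma mps_deriv_const [simp]: "mps_deriv i (mps_const c :: 'v::finite mps) = 0"
proof (rule mps_eqI)
  fix k :: "'v \<Rightarrow>\<^sub>0 nat"
  have "mdeg (k + Poly_Mapping.single i 1) \<noteq> 0" by simp
  then have "k + Poly_Mapping.single i 1 \<noteq> 0" by (metis mdeg_simps(1))
  then show "mps_coeff (mps_deriv i (mps_const c)) k = mps_coeff 0 k"
    by (simp add: mps_coeff_deriv mps_coeff_const)
qed

lemma mps_deriv_1 [simp]: "mps_deriv i (1 :: 'v::finite mps) = 0"
  by (metis mps_deriv_const mps_const_1)

lemma mps_deriv_commute: "mps_deriv i (mps_deriv j f) = mps_deriv j (mps_deriv i f)"
  by (rule mps_eqI) (auto simp: mps_coeff_deriv lookup_add lookup_single when_def ac_simps)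

lemma vanishes_below_deriv: "vanishes_below (Suc n) f \<Longrightarrow> vanishes_below n (mps_deriv i f)"
  by (simp add: vanishes_below_def mps_coeff_deriv)

lemma mps_deriv_const_mult:
  fixes f :: "'v::finite mps"
  shows "mps_deriv i (mps_const c * f) = mps_const c * mps_deriv i f"
  by (rule mps_eqI) (simp add: mps_coeff_deriv mps_coeff_const_mult)

lemma mps_deriv_var_mult:
  fixes f :: "'v::finite mps"
  shows "mps_deriv j (mps_var i * f) = (if i = j then f else 0) + mps_var i * mps_deriv j f"
proof (rule mps_eqI)
  fix k :: "'v \<Rightarrow>\<^sub>0 nat"
  let ?e = "\<lambda>i :: 'v. Poly_Mapping.single i (1 :: nat)"
  have 1: "k + ?e j - ?e j = k" by simp
  have 2: "k - ?e i + ?e i = k" if "0 < Poly_Mapping.lookup k i"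
    using multi_index_split[OF that] by (simp add: add.commute)
  have 3: "k + ?e j - ?e i = k - ?e i + ?e j" if "i \<noteq> j"
    using that by (intro poly_mapping_eqI) (auto simp: lookup_add lookup_minus lookup_single when_def)
  show "mps_coeff (mps_deriv j (mps_var i * f)) k =
    mps_coeff ((if i = j then f else 0) + mps_var i * mps_deriv j f) k"
    using 2 3 by (auto simp: mps_coeff_deriv mps_coeff_var_mult lookup_add lookup_minus lookup_single
        when_def of_nat_diff distrib_right left_diff_distrib)
qed

lemma mps_deriv_var: "mps_deriv j (mps_var i) = (if i = j then 1 else (0 :: 'v::finite mps))"
  using mps_deriv_var_mult[of j i 1] by auto

lemma mps_deriv_mult:
  fixes f :: "'v::finite mps"
  shows "mps_deriv j (f * g) = mps_deriv j f * g + f * mps_deriv j g"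
proof -
  define D where "D f = mps_deriv j (f * g) - (mps_deriv j f * g + f * mps_deriv j g)" for f
  have "D f = 0"
  proof (rule mps_additive_continuous_eq_0[where D = D])
    show "D (f1 + f2) = D f1 + D f2" for f1 f2
      by (simp add: D_def mps_deriv_add algebra_simps)
    show "vanishes_below n (D h)" if "vanishes_below (Suc n) h" for n h
    proof -
      have h: "vanishes_below n h" using that by (rule vanishes_below_mono) simp
      show ?thesis unfolding D_def
        by (intro vanishes_below_diff vanishes_below_add vanishes_below_deriv vanishes_below_mult_right h that)
    qed
    show "D (mps_const c) = 0" for c
      by (simp add: D_def mps_deriv_const_mult)
    show "D (mps_var i * h) = 0" if "D h = 0" for i h
      using that by (simp add: D_def mps_deriv_var_mult mult.assoc distrib_left distrib_right)
  qed
  then show ?thesis by (simp add: D_def)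
qed

text \<open>The chain rule.\<close>

lemma mps_deriv_compose:
  assumes X: "no_const X"
  shows "mps_deriv j (mps_compose f X) = (\<Sum>i\<in>UNIV. mps_compose (mps_deriv i f) X * mps_deriv j (X $ i))"
proof -
  define D where
    "D f = mps_deriv j (mps_compose f X) - (\<Sum>i\<in>UNIV. mps_compose (mps_deriv i f) X * mps_deriv j (X $ i))" for f
  have "D f = 0"
  proof (rule mps_additive_continuous_eq_0[where D = D])
    show "D (f1 + f2) = D f1 + D f2" for f1 f2
      by (simp add: D_def mps_deriv_add mps_compose_add algebra_simps sum.distrib)
    show "vanishes_below n (D h)" if "vanishes_below (Suc n) h" for n h
      unfolding D_def
      by (intro vanishes_below_diff vanishes_below_sum vanishes_below_mult_right
          vanishes_below_compose vanishes_below_deriv X that)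
    show "D (mps_var i * h) = 0" if "D h = 0" for i h
    proof -
      have step: "mps_compose (mps_deriv l (mps_var i * h)) X * mps_deriv j (X $ l) =
         (if i = l then mps_compose h X * mps_deriv j (X $ l) else 0)
         + X $ i * (mps_compose (mps_deriv l h) X * mps_deriv j (X $ l))" for l
        by (simp add: mps_deriv_var_mult mps_compose_add mps_compose_var_mult[OF X] distrib_right mult.assoc)
      show ?thesis
        using that unfolding D_def mps_compose_var_mult[OF X] mps_deriv_mult[of j "X $ i"] step sum.distrib
        by (simp add: mult.commute flip: sum_distrib_left)
    qed
  qed (simp add: D_def)
  then show ?thesis by (simp add: D_def)
qed


section \<open>The group of formal diffeomorphisms\<close>

lemma no_constI_FDiff0: "X \<in> carrier FDiff0 \<Longrightarrow> no_const X"
  by (simp add: FDiff0_def no_const_def)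

lemma mps_coeff_0_mult: "mps_coeff (f * g) 0 = mps_coeff f 0 * mps_coeff (g :: 'v::finite mps) 0"
proof -
  have "mps_coeff (f * g) 0 = (\<Sum>p\<in>{(0 :: 'v \<Rightarrow>\<^sub>0 nat, 0)}. mps_coeff f (fst p) * mps_coeff g (snd p))"
    unfolding mps_coeff_mult
  proof (rule sum.mono_neutral_cong_right[OF finite_multi_index_decompositions])
    show "\<forall>p\<in>{(a, b). a + b = 0} - {(0, 0)}. (case p of (a, b) \<Rightarrow> mps_coeff f a * mps_coeff g b) = 0"
    proof
      fix p :: "('v \<Rightarrow>\<^sub>0 nat) \<times> ('v \<Rightarrow>\<^sub>0 nat)" assume p: "p \<in> {(a, b). a + b = 0} - {(0, 0)}"
      then have "fst p + snd p = 0" by auto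
      then have "mdeg (fst p + snd p) = 0" by (simp del: mdeg_simps(2))
      then have "fst p = 0 \<and> snd p = 0" unfolding mdeg_simps by simp
      with p show "(case p of (a, b) \<Rightarrow> mps_coeff f a * mps_coeff g b) = 0" by auto
    qed
  qed auto
  then show ?thesis by simp
qed

lemma mps_coeff_0_compose: "no_const X \<Longrightarrow> mps_coeff (mps_compose f X) 0 = mps_coeff f 0"
  using vanishes_below_compose[of X 1 "f - mps_const (mps_coeff f 0)"]
  by (simp add: vanishes_below_1_iff mps_coeff_const mps_compose_diff)

text \<open>The chain rule for Jacobian matrices.\<close>

lemma mps_jacobian_compose:
  assumes Y: "no_const Y"
  shows "mps_jacobian (\<chi> i. mps_compose (X $ i) Y) = mat_at (mps_jacobian X) Y ** mps_jacobian Y"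
  by (simp add: vec_eq_iff mps_jacobian_def mat_at_def matrix_matrix_mult_def mps_deriv_compose[OF Y])

lemma linear_part_eq: "linear_part X $ i $ j = mps_coeff (mps_jacobian X $ i $ j) 0"
  by (simp add: linear_part_def mps_jacobian_def mps_coeff_deriv)

lemma linear_part_compose:
  assumes Y: "no_const Y"
  shows "linear_part (\<chi> i. mps_compose (X $ i) Y) = linear_part X ** linear_part Y"
  by (simp add: vec_eq_iff linear_part_eq mps_jacobian_compose[OF Y] matrix_matrix_mult_def
      mps_coeff_sum mps_coeff_0_mult mat_at_def mps_coeff_0_compose[OF Y])

lemma linear_part_id: "linear_part (\<chi> i. mps_var i) = mat 1"
  by (auto simp: single_1_eq_iff vec_eq_iff linear_part_def mat_def mps_coeff_var)

text \<open>In characteristic zero the order of vanishing is detected by the constant term and the partial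
  derivatives.\<close>

lemma vanishes_below_Suc_derivI:
  fixes f :: "'v::finite mps"
  assumes "mps_coeff f 0 = 0" and d: "\<And>j. vanishes_below n (mps_deriv j f)"
  shows "vanishes_below (Suc n) f"
  unfolding vanishes_below_def
proof (intro allI impI)
  fix k :: "'v \<Rightarrow>\<^sub>0 nat" assume k: "mdeg k < Suc n"
  show "mps_coeff f k = 0"
  proof (cases "k = 0")
    case False
    then obtain j where "0 < Poly_Mapping.lookup k j"
      by (metis lookup_zero neq0_conv poly_mapping_eqI)
    then have split: "(k - Poly_Mapping.single j 1) + Poly_Mapping.single j 1 = k"
      by (metis multi_index_split add.commute)
    have "mdeg k = Suc (mdeg (k - Poly_Mapping.single j 1))"
      by (metis split mdeg_simps(2,3) Suc_eq_plus1)
    with k have "mps_coeff (mps_deriv j f) (k - Poly_Mapping.single j 1) = 0"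
      using d[of j] by (simp add: vanishes_below_def)
    with split show ?thesis
      by (simp add: mps_coeff_deriv del: One_nat_def)
  qed (use assms in simp)
qed

text \<open>Substituting a tuple tangent to the identity does not change the lowest-order part. By
  induction on the order: the chain rule expresses the derivatives of \<open>f(X) - f\<close> through
  the same statement for the derivatives of \<open>f\<close>.\<close>

lemma compose_tangent_to_id:
  fixes X :: "'v::finite mps ^ 'v"
  assumes X: "no_const X" and L: "linear_part X = mat 1"
  shows "vanishes_below n f \<Longrightarrow> vanishes_below (Suc n) (mps_compose f X - f)"
proof (induction n arbitrary: f)
  case 0
  then show ?case
    by (simp add: vanishes_below_1_iff mps_coeff_0_compose[OF X])
next
  case (Suc n)
  show ?case
  proof (rule vanishes_below_Suc_derivI)
    show "mps_coeff (mps_compose f X - f) 0 = 0"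
      by (simp add: mps_coeff_0_compose[OF X])
    fix j :: 'v
    let ?\<delta> = "\<lambda>i. (if i = j then 1 else 0) :: 'v mps"
    have "mps_deriv j (mps_compose f X - f) =
        (\<Sum>i\<in>UNIV. mps_compose (mps_deriv i f) X * (mps_deriv j (X $ i) - ?\<delta> i))
        + (mps_compose (mps_deriv j f) X - mps_deriv j f)"
      by (simp add: mps_deriv_diff mps_deriv_compose[OF X] right_diff_distrib sum_subtractf
          if_distrib[of "\<lambda>x. _ * x"] cong: if_cong)
    moreover have "vanishes_below (Suc n) (mps_compose (mps_deriv j f) X - mps_deriv j f)"
      by (intro Suc.IH vanishes_below_deriv Suc.prems)
    moreover have "vanishes_below (n + 1) (mps_compose (mps_deriv i f) X * (mps_deriv j (X $ i) - ?\<delta> i))" for i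
    proof (intro vanishes_below_mult vanishes_below_compose X vanishes_below_deriv Suc.prems)
      have "mps_coeff (mps_deriv j (X $ i)) 0 = mps_coeff (?\<delta> i) 0"
        using arg_cong[OF L, of "\<lambda>M. M $ i $ j"] by (auto simp: linear_part_eq mps_jacobian_def mat_def)
      then show "vanishes_below 1 (mps_deriv j (X $ i) - ?\<delta> i)"
        by (simp add: vanishes_below_1_iff)
    qed
    ultimately show "vanishes_below (Suc n) (mps_deriv j (mps_compose f X - f))"
      by (simp add: vanishes_below_add vanishes_below_sum)
  qed
qed

lemma compose_tangent_to_id_surj:
  fixes X :: "'v::finite mps ^ 'v"
  assumes X: "no_const X" and L: "linear_part X = mat 1"
  shows "\<exists>g. mps_compose g X = h"
proof -
  \<comment> \<open>Successive approximation: each correction by the current error raises its order.\<close>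
  define G where "G = rec_nat 0 (\<lambda>_ g. g + (h - mps_compose g X))"
  have G_Suc: "G (Suc n) = G n + (h - mps_compose (G n) X)" for n
    by (simp add: G_def)
  have err: "vanishes_below n (h - mps_compose (G n) X)" for n
  proof (induction n)
    case (Suc n)
    have "h - mps_compose (G (Suc n)) X =
        - (mps_compose (h - mps_compose (G n) X) X - (h - mps_compose (G n) X))"
      by (simp add: G_Suc mps_compose_add mps_compose_diff algebra_simps)
    then show ?case
      using compose_tangent_to_id[OF X L Suc.IH] vanishes_below_uminus by metis
  qed simp
  \<comment> \<open>The coefficients in degree \<open>d\<close> do not change from \<open>G (Suc d)\<close> on.\<close>
  define g where "g = Abs_mps (\<lambda>m. mps_coeff (G (Suc (mdeg m))) m)"
  have stable: "mps_coeff (G (n + d)) m = mps_coeff (G n) m" if "mdeg m < n" for m n d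
  proof (induction d)
    case (Suc d)
    then show ?case
      using err[of "n + d"] that by (simp add: G_Suc vanishes_below_def)
  qed simp
  have g: "vanishes_below n (g - G n)" for n
    unfolding vanishes_below_def
  proof (intro allI impI)
    fix m :: "'v \<Rightarrow>\<^sub>0 nat" assume "mdeg m < n"
    then show "mps_coeff (g - G n) m = 0"
      using stable[of m "Suc (mdeg m)" "n - Suc (mdeg m)"] by (simp add: g_def)
  qed
  have "mps_compose g X = h"
  proof (rule mps_eqI_vanishes)
    fix n
    have "mps_compose g X - h = mps_compose (g - G n) X - (h - mps_compose (G n) X)"
      by (simp add: mps_compose_diff)
    then show "vanishes_below n (mps_compose g X - h)"
      by (simp only: vanishes_below_diff vanishes_below_compose X g err)
  qed
  then show ?thesis ..
qed

text \<open>The tuple with linear part \<open>A\<close> and no other terms.\<close>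

definition linear_series :: "real ^ 'n ^ 'n \<Rightarrow> 'n::finite mps ^ 'n" where
  "linear_series A = (\<chi> i. \<Sum>j\<in>UNIV. mps_const (A $ i $ j) * mps_var j)"

lemma linear_series_in_FDiff0:
  assumes "invertible A"
  shows "linear_series A \<in> carrier FDiff0" and "linear_part (linear_series A) = A"
proof -
  show L: "linear_part (linear_series A) = A"
    by (auto simp: vec_eq_iff linear_part_def linear_series_def mps_coeff_sum mps_coeff_const_mult
        mps_coeff_var single_1_eq_iff if_distrib[of "\<lambda>x. _ * x"] cong: if_cong)
  show "linear_series A \<in> carrier FDiff0"
    using assms unfolding FDiff0_def
    by (simp add: L) (simp add: linear_series_def mps_coeff_sum mps_coeff_const_mult mps_coeff_var
        single_1_neq_0[symmetric])
qed

text \<open>Composing \<open>X\<close> on the left with the inverse of its linear part makes it tangent to the identity,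
  where \<open>compose_tangent_to_id_surj\<close> applies.\<close>

lemma FDiff0_left_inverse:
  fixes X :: "'n::finite mps ^ 'n"
  assumes "X \<in> carrier FDiff0"
  shows "\<exists>Y\<in>carrier FDiff0. (\<chi> i. mps_compose (Y $ i) X) = (\<chi> i. mps_var i)"
proof -
  have X: "no_const X" and "invertible (linear_part X)"
    using assms by (simp_all add: FDiff0_def no_const_def)
  then obtain B where B: "linear_part X ** B = mat 1" "B ** linear_part X = mat 1"
    by (auto simp: invertible_def)
  then have "invertible B" by (auto simp: invertible_def)
  note T = linear_series_in_FDiff0[OF this]
  let ?T = "linear_series B"
  define Z where "Z = (\<chi> i. mps_compose (?T $ i) X)"
  have Z: "no_const Z" "linear_part Z = mat 1"
    by (simp_all add: Z_def no_const_compose no_constI_FDiff0[OF T(1)] X linear_part_compose T(2) B(2))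
  have "\<forall>i. \<exists>g. mps_compose g Z = mps_var i"
    using compose_tangent_to_id_surj[OF Z] by blast
  then obtain g where g: "\<And>i. mps_compose (g i) Z = mps_var i" by metis
  define G where "G = (\<chi> i. g i)"
  define Y where "Y = (\<chi> i. mps_compose (G $ i) ?T)"
  have GZ: "(\<chi> i. mps_compose (G $ i) Z) = (\<chi> i. mps_var i)"
    by (simp add: G_def g)
  have G: "no_const G"
    unfolding no_const_def
  proof
    fix i
    have "mps_coeff (G $ i) 0 = mps_coeff (mps_compose (G $ i) Z) 0"
      by (simp add: mps_coeff_0_compose[OF Z(1)])
    then show "mps_coeff (G $ i) 0 = 0"
      by (simp add: G_def g mps_coeff_var single_1_neq_0[symmetric])
  qed
  have LG: "linear_part G = mat 1"
    using arg_cong[OF GZ, of linear_part] by (simp add: linear_part_compose[OF Z(1)] Z(2) linear_part_id)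
  have T0: "no_const ?T" by (rule no_constI_FDiff0[OF T(1)])
  have "Y \<in> carrier FDiff0"
    using no_const_compose[OF G T0] \<open>invertible B\<close>
    by (simp add: FDiff0_def Y_def linear_part_compose[OF T0] LG T(2) no_const_def)
  moreover have "mps_compose (Y $ i) X = mps_var i" for i
    using mps_compose_assoc[OF T0 X, of "G $ i"] by (simp add: Y_def G_def g flip: Z_def)
  ultimately show ?thesis by auto
qed

lemma group_FDiff0: "group (FDiff0 :: ('n::finite mps ^ 'n) monoid)"
proof (rule groupI)
  fix X Y Z :: "'n mps ^ 'n"
  assume X: "X \<in> carrier FDiff0" and Y: "Y \<in> carrier FDiff0" and Z: "Z \<in> carrier FDiff0"
  note nc = no_constI_FDiff0[OF X] no_constI_FDiff0[OF Y] no_constI_FDiff0[OF Z]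
  show "X \<otimes>\<^bsub>FDiff0\<^esub> Y \<in> carrier FDiff0"
    using X Y no_const_compose[OF nc(1,2)]
    by (simp add: FDiff0_def linear_part_compose[OF nc(2)] invertible_mult no_const_def)
  show "X \<otimes>\<^bsub>FDiff0\<^esub> Y \<otimes>\<^bsub>FDiff0\<^esub> Z = X \<otimes>\<^bsub>FDiff0\<^esub> (Y \<otimes>\<^bsub>FDiff0\<^esub> Z)"
    by (simp add: FDiff0_def mps_compose_assoc[OF nc(2,3)])
  show "\<one>\<^bsub>FDiff0\<^esub> \<otimes>\<^bsub>FDiff0\<^esub> X = X"
    by (simp add: FDiff0_def mps_compose_var[OF nc(1)] vec_eq_iff)
  show "\<exists>Y\<in>carrier FDiff0. Y \<otimes>\<^bsub>FDiff0\<^esub> X = \<one>\<^bsub>FDiff0\<^esub>"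
    using FDiff0_left_inverse[OF X] by (simp add: FDiff0_def)
next
  show "\<one>\<^bsub>FDiff0\<^esub> \<in> carrier (FDiff0 :: ('n mps ^ 'n) monoid)"
    using no_const_var[of "\<lambda>i :: 'n. i"]
    by (simp add: FDiff0_def linear_part_id no_const_def) (auto simp: invertible_def)
qed

lemma FDiff0_mult: "X \<otimes>\<^bsub>FDiff0\<^esub> Y = (\<chi> i. mps_compose (X $ i) Y)"
  by (simp add: FDiff0_def)

lemma FDiff0_one: "\<one>\<^bsub>FDiff0\<^esub> = (\<chi> i. mps_var i)"
  by (simp add: FDiff0_def)


section \<open>Substitution into matrices of series\<close>

text \<open>Entrywise substitution, for rectangular matrices whose format need not match the number of
  variables, so that it also applies to matrices of series in \<open>(u, v)\<close>.\<close>

definition mat_subst :: "'v::finite mps ^ 'm ^ 'k \<Rightarrow> 'w::finite mps ^ 'v \<Rightarrow> 'w mps ^ 'm ^ 'k" where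
  "mat_subst M p = (\<chi> i j. mps_compose (M $ i $ j) p)"

lemma mat_at_eq_mat_subst: "mat_at = mat_subst"
  by (simp add: fun_eq_iff mat_at_def mat_subst_def)

lemma mat_subst_mult:
  "no_const p \<Longrightarrow> mat_subst (M ** N) p = mat_subst M p ** mat_subst N p"
  by (simp add: vec_eq_iff mat_subst_def matrix_matrix_mult_def mps_compose_sum mps_compose_mult)

lemma mat_subst_transpose: "mat_subst (transpose M) p = transpose (mat_subst M p)"
  by (simp add: vec_eq_iff mat_subst_def transpose_def)

lemma mat_subst_mat_1 [simp]: "mat_subst (mat 1) p = mat 1"
  by (simp add: vec_eq_iff mat_subst_def mat_def)

lemma mat_subst_assoc:
  "no_const p \<Longrightarrow> no_const q \<Longrightarrow>
    mat_subst (mat_subst M p) q = mat_subst M (\<chi> i. mps_compose (p $ i) q)"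
  by (simp add: mat_subst_def mps_compose_assoc)

lemma mat_subst_id [simp]: "mat_subst M (\<chi> i. mps_var i) = M"
  by (simp add: vec_eq_iff mat_subst_def)

lemma mps_jacobian_id: "mps_jacobian (\<chi> i. mps_var i) = mat 1"
  by (simp add: vec_eq_iff mps_jacobian_def mps_deriv_var mat_def)

text \<open>Both one-sided inverses come from the chain rule: differentiate \<open>Y(X) = id\<close>, and differentiate
  \<open>X(Y) = id\<close> and then substitute \<open>X\<close>.\<close>

lemma invertible_mps_jacobian:
  assumes X: "X \<in> carrier FDiff0"
  shows "invertible (mps_jacobian X)"
proof -
  interpret group FDiff0 by (rule group_FDiff0)
  let ?Y = "inv\<^bsub>FDiff0\<^esub> X"
  have Y: "?Y \<in> carrier FDiff0" using X by simp
  note nc = no_constI_FDiff0[OF X] no_constI_FDiff0[OF Y]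
  have YX: "(\<chi> i. mps_compose (?Y $ i) X) = (\<chi> i. mps_var i)"
    using l_inv[OF X] by (simp add: FDiff0_mult FDiff0_one)
  have XY: "(\<chi> i. mps_compose (X $ i) ?Y) = (\<chi> i. mps_var i)"
    using r_inv[OF X] by (simp add: FDiff0_mult FDiff0_one)
  have "mat_subst (mps_jacobian ?Y) X ** mps_jacobian X = mat 1"
    using mps_jacobian_compose[OF nc(1), of ?Y] by (simp add: YX mps_jacobian_id mat_at_eq_mat_subst)
  moreover have "mat_subst (mps_jacobian X) ?Y ** mps_jacobian ?Y = mat 1"
    using mps_jacobian_compose[OF nc(2), of X] by (simp add: XY mps_jacobian_id mat_at_eq_mat_subst)
  from arg_cong[OF this, of "\<lambda>M. mat_subst M X"]
  have "mps_jacobian X ** mat_subst (mps_jacobian ?Y) X = mat 1"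
    by (simp add: mat_subst_mult nc mat_subst_assoc YX)
  ultimately show ?thesis by (auto simp: invertible_def)
qed

lemma matrix_inv_inverse:
  assumes "invertible A"
  shows "A ** matrix_inv A = mat 1" "matrix_inv A ** A = mat 1"
  using someI_ex[OF assms[unfolded invertible_def]] by (simp_all add: matrix_inv_def)


section \<open>Substitution at two points\<close>

text \<open>The substitution \<open>u = p\<close>, \<open>v = q\<close>.\<close>

definition two_points :: "'w mps ^ 'n \<Rightarrow> 'w mps ^ 'n \<Rightarrow> 'w mps ^ ('n::finite + 'n)" where
  "two_points p q = (\<chi> x. case x of Inl i \<Rightarrow> p $ i | Inr i \<Rightarrow> q $ i)"

text \<open>The point \<open>(X(u), X(v))\<close>.\<close>

definition doubled :: "'n::finite mps ^ 'n \<Rightarrow> ('n + 'n) mps ^ ('n + 'n)" where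
  "doubled X = two_points (\<chi> m. mps_compose (X $ m) var_u) (\<chi> m. mps_compose (X $ m) var_v)"

lemma at2_eq: "at2 f p q = mps_compose f (two_points p q)"
  by (simp add: at2_def two_points_def)

lemma no_const_two_points: "no_const p \<Longrightarrow> no_const q \<Longrightarrow> no_const (two_points p q)"
  by (auto simp: no_const_def two_points_def split: sum.split)

lemma no_const_var_u: "no_const var_u" and no_const_var_v: "no_const var_v"
  unfolding var_u_def var_v_def by (rule no_const_var)+

lemma no_const_doubled: "no_const X \<Longrightarrow> no_const (doubled X)"
  unfolding doubled_def
  by (intro no_const_two_points no_const_compose no_const_var_u no_const_var_v)

lemma compose_var_u_two_points:
  assumes "no_const p" "no_const q"
  shows "mps_compose (mps_compose f var_u) (two_points p q) = mps_compose f p"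
    and "mps_compose (mps_compose f var_v) (two_points p q) = mps_compose f q"
proof -
  have "mps_compose (mps_var x) (two_points p q) = two_points p q $ x" for x
    by (rule mps_compose_var[OF no_const_two_points[OF assms]])
  then show "mps_compose (mps_compose f var_u) (two_points p q) = mps_compose f p"
    and "mps_compose (mps_compose f var_v) (two_points p q) = mps_compose f q"
    by (simp_all add: mps_compose_assoc no_const_var_u no_const_var_v no_const_two_points assms)
       (simp_all add: var_u_def var_v_def two_points_def)
qed

lemma compose_var_u_doubled:
  assumes X: "no_const X"
  shows "mps_compose (mps_compose f var_u) (doubled X) = mps_compose (mps_compose f X) var_u"
    and "mps_compose (mps_compose f var_v) (doubled X) = mps_compose (mps_compose f X) var_v"
  unfolding doubled_def
  by (simp_all add: compose_var_u_two_points no_const_compose X no_const_var_u no_const_var_v mps_compose_assoc)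

lemma doubled_compose:
  assumes "no_const X" and Y: "no_const Y"
  shows "(\<chi> x. mps_compose (doubled X $ x) (doubled Y)) = doubled (\<chi> i. mps_compose (X $ i) Y)"
proof -
  have "mps_compose (doubled X $ x) (doubled Y) = doubled (\<chi> i. mps_compose (X $ i) Y) $ x" for x
    using compose_var_u_doubled[OF Y]
    by (cases x) (simp_all add: doubled_def[of X] doubled_def[of "\<chi> i. mps_compose (X $ i) Y"] two_points_def)
  then show ?thesis by (simp add: vec_eq_iff)
qed

lemma doubled_id: "doubled (\<chi> i. mps_var i) = (\<chi> x. mps_var x)"
proof -
  have "doubled (\<chi> i. mps_var i) $ x = mps_var x" for x :: "'a + 'a"
    by (cases x) (simp_all add: doubled_def two_points_def mps_compose_var no_const_var_u no_const_var_v,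
        simp_all add: var_u_def var_v_def)
  then show ?thesis by (simp add: vec_eq_iff)
qed


section \<open>The push-forward is a group action\<close>

text \<open>The equation that characterises \<open>\<psi> = X \<cdot> \<phi>\<close>, in matrix form. Working with this relation
  instead of the definite description makes composition and inversion direct computations.\<close>

definition is_push :: "'n::finite mps ^ 'n \<Rightarrow> 'n bifamily \<Rightarrow> 'n bifamily \<Rightarrow> bool" where
  "is_push X \<phi> \<psi> \<longleftrightarrow> mat_subst \<psi> (doubled X) =
     mat_subst (mps_jacobian X) var_u ** \<phi> ** transpose (mat_subst (mps_jacobian X) var_v)"

lemma sandwich_nth:
  fixes M :: "'a::comm_semiring_1 ^ 'k ^ 'i" and N :: "'a ^ 'l ^ 'j" and \<phi> :: "'a ^ 'l ^ 'k"
  shows "(M ** \<phi> ** transpose N) $ i $ j = (\<Sum>k\<in>UNIV. \<Sum>l\<in>UNIV. M $ i $ k * N $ j $ l * \<phi> $ k $ l)"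
proof -
  have "(M ** \<phi> ** transpose N) $ i $ j = (\<Sum>l\<in>UNIV. \<Sum>k\<in>UNIV. M $ i $ k * N $ j $ l * \<phi> $ k $ l)"
    by (simp add: matrix_matrix_mult_def transpose_def sum_distrib_left sum_distrib_right ac_simps)
  also have "\<dots> = (\<Sum>k\<in>UNIV. \<Sum>l\<in>UNIV. M $ i $ k * N $ j $ l * \<phi> $ k $ l)"
    by (rule sum.swap)
  finally show ?thesis .
qed

lemma push_forward_eq_The: "push_forward X \<phi> = (THE \<psi>. is_push X \<phi> \<psi>)"
  unfolding push_forward_def is_push_def vec_eq_iff sandwich_nth
  by (simp add: at2_eq mat_subst_def mat_at_eq_mat_subst doubled_def)

lemma is_push_id_iff: "is_push (\<chi> i. mps_var i) \<phi> \<psi> \<longleftrightarrow> \<psi> = \<phi>"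
  by (simp add: is_push_def doubled_id mps_jacobian_id transpose_mat)

lemma is_push_trans:
  assumes Y: "no_const Y" and X: "no_const X" and 1: "is_push Y \<phi> \<psi>" and 2: "is_push X \<psi> \<theta>"
  shows "is_push (\<chi> i. mps_compose (X $ i) Y) \<phi> \<theta>"
proof -
  note nc = no_const_doubled[OF X] no_const_doubled[OF Y] no_const_var_u no_const_var_v
  let ?J = "mps_jacobian"
  have J: "mat_subst (mat_subst (?J X) var_u) (doubled Y) = mat_subst (mat_subst (?J X) Y) var_u"
    "mat_subst (mat_subst (?J X) var_v) (doubled Y) = mat_subst (mat_subst (?J X) Y) var_v"
    by (simp_all add: mat_subst_def compose_var_u_doubled[OF Y])
  have "mat_subst \<theta> (doubled (\<chi> i. mps_compose (X $ i) Y)) = mat_subst (mat_subst \<theta> (doubled X)) (doubled Y)"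
    by (simp add: mat_subst_assoc nc doubled_compose[OF X Y])
  also have "\<dots> = mat_subst (mat_subst (?J X) Y) var_u ** (mat_subst (?J Y) var_u ** \<phi> **
      transpose (mat_subst (?J Y) var_v)) ** transpose (mat_subst (mat_subst (?J X) Y) var_v)"
    using 1 2 by (simp add: is_push_def mat_subst_mult nc mat_subst_transpose J)
  finally show ?thesis
    by (simp add: is_push_def mps_jacobian_compose[OF Y] mat_at_eq_mat_subst mat_subst_mult nc
        matrix_transpose_mul matrix_mul_assoc)
qed

lemma mat_subst_doubled_inverse:
  assumes X: "X \<in> carrier FDiff0"
  shows "mat_subst (mat_subst M (doubled X)) (doubled (inv\<^bsub>FDiff0\<^esub> X)) = M"
    and "mat_subst (mat_subst M (doubled (inv\<^bsub>FDiff0\<^esub> X))) (doubled X) = M"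
proof -
  interpret group FDiff0 by (rule group_FDiff0)
  have Y: "inv\<^bsub>FDiff0\<^esub> X \<in> carrier FDiff0" using X by simp
  note nc = no_constI_FDiff0[OF X] no_constI_FDiff0[OF Y]
  have "(\<chi> i. mps_compose ((inv\<^bsub>FDiff0\<^esub> X) $ i) X) = (\<chi> i. mps_var i)"
    using l_inv[OF X] by (simp add: FDiff0_mult FDiff0_one)
  moreover have "(\<chi> i. mps_compose (X $ i) (inv\<^bsub>FDiff0\<^esub> X)) = (\<chi> i. mps_var i)"
    using r_inv[OF X] by (simp add: FDiff0_mult FDiff0_one)
  ultimately show "mat_subst (mat_subst M (doubled X)) (doubled (inv\<^bsub>FDiff0\<^esub> X)) = M"
    and "mat_subst (mat_subst M (doubled (inv\<^bsub>FDiff0\<^esub> X))) (doubled X) = M"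
    by (simp_all add: mat_subst_assoc no_const_doubled nc doubled_compose doubled_id)
qed

lemma ex1_is_push:
  assumes X: "X \<in> carrier FDiff0"
  shows "\<exists>!\<psi>. is_push X \<phi> \<psi>"
  unfolding is_push_def by (metis mat_subst_doubled_inverse[OF X])

lemma push_forward_eq_iff:
  assumes "X \<in> carrier FDiff0"
  shows "push_forward X \<phi> = \<psi> \<longleftrightarrow> is_push X \<phi> \<psi>"
  using theI'[OF ex1_is_push[OF assms, of \<phi>]] ex1_is_push[OF assms, of \<phi>]
  by (auto simp: push_forward_eq_The)

lemma is_push_inverse:
  assumes X: "X \<in> carrier FDiff0" and 1: "is_push X \<phi> \<psi>"
  shows "is_push (inv\<^bsub>FDiff0\<^esub> X) \<psi> \<phi>"
proof -
  interpret group FDiff0 by (rule group_FDiff0)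
  have Y: "inv\<^bsub>FDiff0\<^esub> X \<in> carrier FDiff0" using X by simp
  obtain \<theta> where \<theta>: "is_push (inv\<^bsub>FDiff0\<^esub> X) \<psi> \<theta>"
    using ex1_is_push[OF Y] by blast
  have "is_push (inv\<^bsub>FDiff0\<^esub> X \<otimes>\<^bsub>FDiff0\<^esub> X) \<phi> \<theta>"
    unfolding FDiff0_mult by (rule is_push_trans[OF _ _ 1 \<theta>]) (simp_all add: no_constI_FDiff0 X Y)
  then have "\<theta> = \<phi>"
    by (simp add: l_inv[OF X] FDiff0_one is_push_id_iff)
  with \<theta> show ?thesis by simp
qed

lemma mem_orbit_iff: "\<psi> \<in> orbit FDiff0 push_forward \<phi> \<longleftrightarrow> (\<exists>X\<in>carrier FDiff0. is_push X \<phi> \<psi>)"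
  unfolding orbit_def mem_Collect_eq by (metis push_forward_eq_iff)

lemma orbit_trans_FDiff0:
  assumes "\<psi> \<in> orbit FDiff0 push_forward \<phi>" "\<theta> \<in> orbit FDiff0 push_forward \<psi>"
  shows "\<theta> \<in> orbit FDiff0 push_forward \<phi>"
proof -
  interpret group FDiff0 by (rule group_FDiff0)
  obtain X Y where XY: "X \<in> carrier FDiff0" "Y \<in> carrier FDiff0" "is_push Y \<phi> \<psi>" "is_push X \<psi> \<theta>"
    using assms by (auto simp: mem_orbit_iff)
  then have "is_push (X \<otimes>\<^bsub>FDiff0\<^esub> Y) \<phi> \<theta>"
    unfolding FDiff0_mult by (intro is_push_trans[of Y X \<phi> \<psi> \<theta>] no_constI_FDiff0)
  moreover have "X \<otimes>\<^bsub>FDiff0\<^esub> Y \<in> carrier FDiff0" using XY by simp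
  ultimately show ?thesis unfolding mem_orbit_iff by blast
qed

lemma orbit_sym_FDiff0:
  assumes "\<psi> \<in> orbit FDiff0 push_forward \<phi>"
  shows "\<phi> \<in> orbit FDiff0 push_forward \<psi>"
proof -
  interpret group FDiff0 by (rule group_FDiff0)
  show ?thesis using assms is_push_inverse inv_closed unfolding mem_orbit_iff by blast
qed

lemma orbit_eqI_FDiff0:
  assumes "\<psi> \<in> orbit FDiff0 push_forward \<phi>"
  shows "orbit FDiff0 push_forward \<psi> = orbit FDiff0 push_forward \<phi>"
  using orbit_trans_FDiff0 orbit_sym_FDiff0 assms by blast


section \<open>The Yang--Baxter equation for \<open>\<phi>\<^sub>F\<close>\<close>

text \<open>In the coordinates \<open>F\<close>, the fields \<open>translation_field F\<close> and \<open>euler_field F\<close> are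
  \<open>\<Sum>\<^sub>k \<partial>\<^sub>k\<close> and \<open>\<Sum>\<^sub>k F\<^sup>k \<partial>\<^sub>k\<close>.\<close>

definition translation_field :: "'n::finite mps ^ 'n \<Rightarrow> 'n mps ^ 'n" where
  "translation_field F = matrix_inv (mps_jacobian F) *v (\<chi> k. 1)"

definition euler_field :: "'n::finite mps ^ 'n \<Rightarrow> 'n mps ^ 'n" where
  "euler_field F = matrix_inv (mps_jacobian F) *v F"

text \<open>The Lie bracket \<open>[X, Y]\<close> of the vector fields with components \<open>X\<close> and \<open>Y\<close>.\<close>

definition bracket :: "'n::finite mps ^ 'n \<Rightarrow> 'n mps ^ 'n \<Rightarrow> 'n mps ^ 'n" where
  "bracket X Y = (\<chi> i. \<Sum>s\<in>UNIV. X $ s * mps_deriv s (Y $ i) - Y $ s * mps_deriv s (X $ i))"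

text \<open>Since \<open>J\<close> is invertible, it suffices that both sides agree after multiplication by \<open>J\<close>. There
  the derivatives of \<open>J \<sigma> = (1, \<dots>, 1)\<close> and \<open>J E = F\<close> apply, and the second derivatives of \<open>F\<close>
  cancel by symmetry; no derivative of \<open>J\<^sup>-\<^sup>1\<close> is needed.\<close>

lemma bracket_translation_euler:
  assumes "invertible (mps_jacobian F)"
  shows "bracket (translation_field F) (euler_field F) = translation_field F"
proof -
  let ?J = "mps_jacobian F" and ?P = "matrix_inv (mps_jacobian F)"
  define S where "S = translation_field F"
  define E where "E = euler_field F"
  note inv = matrix_inv_inverse[OF assms]
  have JS: "?J *v S = (\<chi> k. 1)" and JE: "?J *v E = F"
    by (simp_all add: S_def E_def translation_field_def euler_field_def matrix_vector_mul_assoc inv)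
  let ?H = "\<lambda>m s i. mps_deriv s (?J $ m $ i)"
  have H_sym: "?H m s i = ?H m i s" for m s i
    by (simp add: mps_jacobian_def mps_deriv_commute)
  have dS: "(\<Sum>i\<in>UNIV. ?J $ m $ i * mps_deriv s (S $ i)) = - (\<Sum>i\<in>UNIV. ?H m s i * S $ i)" for m s
    using arg_cong[OF JS, of "\<lambda>V. mps_deriv s (V $ m)"]
    by (simp add: matrix_vector_mult_def mps_deriv_sum mps_deriv_mult sum.distrib eq_neg_iff_add_eq_0 add.commute)
  have dE: "(\<Sum>i\<in>UNIV. ?J $ m $ i * mps_deriv s (E $ i)) = ?J $ m $ s - (\<Sum>i\<in>UNIV. ?H m s i * E $ i)" for m s
  proof -
    have "mps_deriv s (F $ m) = ?J $ m $ s" by (simp add: mps_jacobian_def)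
    then show ?thesis
      using arg_cong[OF JE, of "\<lambda>V. mps_deriv s (V $ m)"]
      by (simp add: matrix_vector_mult_def mps_deriv_sum mps_deriv_mult sum.distrib eq_diff_eq add.commute)
  qed
  have "(?J *v bracket S E) $ m = 1" for m
  proof -
    have "(?J *v bracket S E) $ m = (\<Sum>i\<in>UNIV. \<Sum>s\<in>UNIV.
        S $ s * (?J $ m $ i * mps_deriv s (E $ i)) - E $ s * (?J $ m $ i * mps_deriv s (S $ i)))"
      by (simp add: matrix_vector_mult_def bracket_def sum_distrib_left right_diff_distrib ac_simps)
    also have "\<dots> = (\<Sum>s\<in>UNIV. S $ s * (\<Sum>i\<in>UNIV. ?J $ m $ i * mps_deriv s (E $ i))
        - E $ s * (\<Sum>i\<in>UNIV. ?J $ m $ i * mps_deriv s (S $ i)))"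
      by (subst sum.swap) (simp add: sum_distrib_left sum_subtractf)
    also have "\<dots> = (\<Sum>s\<in>UNIV. ?J $ m $ s * S $ s)
        - (\<Sum>s\<in>UNIV. \<Sum>i\<in>UNIV. S $ s * (?H m s i * E $ i)) + (\<Sum>s\<in>UNIV. \<Sum>i\<in>UNIV. E $ s * (?H m s i * S $ i))"
      unfolding dS dE by (simp add: sum_subtractf sum.distrib sum_distrib_left right_diff_distrib ac_simps)
    also have "(\<Sum>s\<in>UNIV. \<Sum>i\<in>UNIV. E $ s * (?H m s i * S $ i)) =
        (\<Sum>s\<in>UNIV. \<Sum>i\<in>UNIV. S $ s * (?H m s i * E $ i))"
      by (subst sum.swap) (intro sum.cong refl, subst H_sym, simp only: ac_simps)
    also have "(\<Sum>s\<in>UNIV. ?J $ m $ s * S $ s) = 1"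
      using arg_cong[OF JS, of "\<lambda>V. V $ m"] by (simp add: matrix_vector_mult_def)
    finally show ?thesis by simp
  qed
  then have "?J *v bracket S E = (\<chi> k. 1)" by (simp add: vec_eq_iff)
  then have "?P *v (?J *v bracket S E) = S"
    by (simp add: S_def translation_field_def)
  then show ?thesis
    by (simp add: matrix_vector_mul_assoc inv S_def E_def)
qed

lemma phi_eq_sandwich:
  "phi F = mat_subst (matrix_inv (mps_jacobian F)) var_u **
     (\<chi> k l. mps_compose (F $ k) var_u - mps_compose (F $ l) var_v) **
     transpose (mat_subst (matrix_inv (mps_jacobian F)) var_v)"
  by (simp add: vec_eq_iff sandwich_nth phi_def Let_def mat_at_eq_mat_subst)

lemma phi_eq_wedge:
  "phi F $ i $ j =
     mps_compose (euler_field F $ i) var_u * mps_compose (translation_field F $ j) var_v -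
     mps_compose (translation_field F $ i) var_u * mps_compose (euler_field F $ j) var_v"
  by (simp add: phi_def Let_def mat_at_def euler_field_def translation_field_def matrix_vector_mult_def
      mps_compose_sum mps_compose_mult no_const_var_u no_const_var_v sum_product
      right_diff_distrib sum_subtractf ac_simps) (rule sum.swap)

lemma at2_phi:
  assumes "no_const p" "no_const q"
  shows "at2 (phi F $ i $ j) p q =
     mps_compose (euler_field F $ i) p * mps_compose (translation_field F $ j) q -
     mps_compose (translation_field F $ i) p * mps_compose (euler_field F $ j) q"
  by (simp add: at2_eq phi_eq_wedge mps_compose_diff mps_compose_mult no_const_two_points assms
      compose_var_u_two_points)

text \<open>Derivatives of a series at one of several points, whose variables are selected by \<open>h\<close>.\<close>

lemma mps_deriv_rename:
  fixes h :: "'v::finite \<Rightarrow> 'w::finite"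
  assumes "inj h"
  shows "mps_deriv (h s) (mps_compose f (\<chi> i. mps_var (h i))) = mps_compose (mps_deriv s f) (\<chi> i. mps_var (h i))"
  by (simp add: mps_deriv_compose[OF no_const_var] mps_deriv_var inj_eq[OF assms]
      if_distrib[of "\<lambda>x. _ * x"] cong: if_cong)

lemma mps_deriv_rename_0:
  fixes h :: "'v::finite \<Rightarrow> 'w::finite"
  assumes "t \<notin> range h"
  shows "mps_deriv t (mps_compose f (\<chi> i. mps_var (h i))) = 0"
  using assms by (auto simp: mps_deriv_compose[OF no_const_var] mps_deriv_var intro!: sum.neutral)

text \<open>The two terms of the Yang--Baxter equation with a derivative at the same point \<open>p\<close> add up to
  an expression in which only the bracket of the two fields is differentiated.\<close>

lemma CYBE_pair:
  fixes a b c :: "'n::finite \<Rightarrow> 'w::finite" and F :: "'n mps ^ 'n"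
  assumes F: "invertible (mps_jacobian F)" and "inj a" and b: "range a \<inter> range b = {}" and c: "range a \<inter> range c = {}"
  defines "p \<equiv> (\<chi> i. mps_var (a i))" and "q \<equiv> (\<chi> i. mps_var (b i))" and "r \<equiv> (\<chi> i. mps_var (c i))"
  defines "E \<equiv> \<lambda>i. mps_compose (euler_field F $ i)" and "S \<equiv> \<lambda>i. mps_compose (translation_field F $ i)"
  shows "(\<Sum>s\<in>UNIV. at2 (phi F $ k $ s) r p * mps_deriv (a s) (at2 (phi F $ i $ j) p q)
      + at2 (phi F $ s $ j) p q * mps_deriv (a s) (at2 (phi F $ i $ k) p r))
    = (E k r * S j q - E j q * S k r) * S i p"
proof -
  have nc: "no_const p" "no_const q" "no_const r"
    unfolding p_def q_def r_def by (rule no_const_var)+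
  have dq: "mps_deriv (a s) (mps_compose f q) = 0" for s f
    unfolding q_def using b by (intro mps_deriv_rename_0) auto
  have dr: "mps_deriv (a s) (mps_compose f r) = 0" for s f
    unfolding r_def using c by (intro mps_deriv_rename_0) auto
  have dp: "mps_deriv (a s) (mps_compose f p) = mps_compose (mps_deriv s f) p" for s f
    unfolding p_def by (rule mps_deriv_rename[OF \<open>inj a\<close>])
  have "S i p = mps_compose (bracket (translation_field F) (euler_field F) $ i) p"
    by (simp add: S_def bracket_translation_euler[OF F])
  also have "\<dots> = (\<Sum>s\<in>UNIV. S s p * mps_deriv (a s) (E i p) - E s p * mps_deriv (a s) (S i p))"
    by (simp add: bracket_def mps_compose_sum mps_compose_diff mps_compose_mult nc S_def E_def dp)
  finally have Sip: "S i p = \<dots>" .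
  have "at2 (phi F $ k $ s) r p * mps_deriv (a s) (at2 (phi F $ i $ j) p q)
      + at2 (phi F $ s $ j) p q * mps_deriv (a s) (at2 (phi F $ i $ k) p r) =
      (E k r * S j q - E j q * S k r) * (S s p * mps_deriv (a s) (E i p) - E s p * mps_deriv (a s) (S i p))" for s
    by (simp add: at2_phi nc mps_deriv_diff mps_deriv_mult dq dr E_def S_def algebra_simps)
  then show ?thesis
    by (subst Sip) (simp add: sum_distrib_left)
qed

lemma CYBE_solution_phi:
  fixes F :: "'n::finite mps ^ 'n"
  assumes F: "invertible (mps_jacobian F)"
  shows "CYBE_solution (phi F)"
proof -
  let ?iu = "\<lambda>s :: 'n. Inl s :: 'n + 'n + 'n" and ?iv = "\<lambda>s :: 'n. Inr (Inl s) :: 'n + 'n + 'n"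
    and ?iw = "\<lambda>s :: 'n. Inr (Inr s) :: 'n + 'n + 'n"
  let ?u = "\<chi> i. mps_var (?iu i)" and ?v = "\<chi> i. mps_var (?iv i)" and ?w = "\<chi> i. mps_var (?iw i)"
  let ?\<Phi> = "\<lambda>i j. at2 (phi F $ i $ j)"
  have inj: "inj ?iu" "inj ?iv" "inj ?iw"
    by (simp_all add: inj_def)
  have disj: "range ?iu \<inter> range ?iv = {}" "range ?iv \<inter> range ?iu = {}" "range ?iu \<inter> range ?iw = {}"
    "range ?iw \<inter> range ?iu = {}" "range ?iv \<inter> range ?iw = {}" "range ?iw \<inter> range ?iv = {}"
    by auto
  have anti: "phi F $ i $ j = - at2 (phi F $ j $ i) var_v var_u" for i j
    using phi_eq_wedge[of F i j] at2_phi[OF no_const_var_v no_const_var_u, of F j i]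
    by (simp add: mult.commute)
  have "(\<Sum>s\<in>UNIV.
             ?\<Phi> k s ?w ?u * mps_deriv (?iu s) (?\<Phi> i j ?u ?v)
           + ?\<Phi> s k ?v ?w * mps_deriv (?iv s) (?\<Phi> j i ?v ?u)
           + ?\<Phi> i s ?u ?v * mps_deriv (?iv s) (?\<Phi> j k ?v ?w)
           + ?\<Phi> s i ?w ?u * mps_deriv (?iw s) (?\<Phi> k j ?w ?v)
           + ?\<Phi> j s ?v ?w * mps_deriv (?iw s) (?\<Phi> k i ?w ?u)
           + ?\<Phi> s j ?u ?v * mps_deriv (?iu s) (?\<Phi> i k ?u ?w)) = 0" (is "?lhs = 0") for i j k
  proof -
    have "?lhs =
        (\<Sum>s\<in>UNIV. ?\<Phi> k s ?w ?u * mps_deriv (?iu s) (?\<Phi> i j ?u ?v)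
           + ?\<Phi> s j ?u ?v * mps_deriv (?iu s) (?\<Phi> i k ?u ?w))
      + (\<Sum>s\<in>UNIV. ?\<Phi> i s ?u ?v * mps_deriv (?iv s) (?\<Phi> j k ?v ?w)
           + ?\<Phi> s k ?v ?w * mps_deriv (?iv s) (?\<Phi> j i ?v ?u))
      + (\<Sum>s\<in>UNIV. ?\<Phi> j s ?v ?w * mps_deriv (?iw s) (?\<Phi> k i ?w ?u)
           + ?\<Phi> s i ?w ?u * mps_deriv (?iw s) (?\<Phi> k j ?w ?v))"
      by (simp only: sum.distrib ac_simps)
    also have "\<dots> = 0"
      unfolding CYBE_pair[OF F inj(1) disj(1) disj(3)] CYBE_pair[OF F inj(2) disj(5) disj(2)]
        CYBE_pair[OF F inj(3) disj(4) disj(6)]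
      by (simp add: algebra_simps)
    finally show ?thesis .
  qed
  with anti show ?thesis
    unfolding CYBE_solution_def Let_def by blast
qed


section \<open>The canonical representative\<close>

lemma phi_id: "phi (\<chi> i. mps_var i) = (\<chi> i j. var_u $ i - var_v $ j)"
proof -
  have "matrix_inv (mat 1 :: 'a mps ^ 'a ^ 'a) = mat 1"
    using matrix_inv_inverse(1)[of "mat 1 :: 'a mps ^ 'a ^ 'a"] by (auto simp: invertible_def)
  then show ?thesis
    by (simp add: phi_eq_sandwich mps_jacobian_id transpose_mat mps_compose_var no_const_var_u no_const_var_v)
qed

text \<open>The tuple \<open>F\<close>, seen as a change of coordinates, takes \<open>\<phi>\<^sub>F\<close> to the canonical solution.\<close>

lemma is_push_phi:
  fixes F :: "'n::finite mps ^ 'n"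
  assumes F: "F \<in> carrier FDiff0"
  shows "is_push F (phi F) (phi (\<chi> i. mps_var i))"
proof -
  let ?J = "mps_jacobian F" and ?P = "matrix_inv (mps_jacobian F)"
  let ?D = "\<chi> k l. mps_compose (F $ k) var_u - mps_compose (F $ l) var_v"
  note nc = no_constI_FDiff0[OF F]
  note inv = matrix_inv_inverse(1)[OF invertible_mps_jacobian[OF F]]
  have J: "mat_subst ?J p ** mat_subst ?P p = mat 1" if "no_const p" for p :: "('n + 'n) mps ^ 'n"
    by (simp add: inv flip: mat_subst_mult[OF that])
  have "mps_compose (var_u $ i) (doubled F) = mps_compose (F $ i) var_u"
    "mps_compose (var_v $ i) (doubled F) = mps_compose (F $ i) var_v" for i
    using mps_compose_var[OF no_const_doubled[OF nc]]
    by (simp_all add: var_u_def var_v_def) (simp_all add: doubled_def two_points_def var_u_def var_v_def)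
  then have "mat_subst (phi (\<chi> i. mps_var i)) (doubled F) = ?D"
    by (simp add: phi_id mat_subst_def mps_compose_diff)
  also have "\<dots> = (mat_subst ?J var_u ** mat_subst ?P var_u) ** ?D **
      transpose (mat_subst ?J var_v ** mat_subst ?P var_v)"
    by (simp add: J no_const_var_u no_const_var_v transpose_mat)
  finally show ?thesis
    by (simp add: is_push_def phi_eq_sandwich matrix_transpose_mul matrix_mul_assoc)
qed

lemma orbit_phi_id:
  "orbit FDiff0 push_forward (phi (\<chi> i. mps_var i)) = phi ` (carrier FDiff0 :: ('n::finite mps ^ 'n) set)"
    (is "?O = _")
proof -
  interpret group "FDiff0 :: ('n mps ^ 'n) monoid" by (rule group_FDiff0)
  have "phi F \<in> ?O" if "F \<in> carrier FDiff0" for F :: "'n mps ^ 'n"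
    using is_push_inverse[OF that is_push_phi[OF that]] that inv_closed unfolding mem_orbit_iff by blast
  moreover have "\<psi> \<in> phi ` carrier FDiff0" if \<psi>: "\<psi> \<in> ?O" for \<psi> :: "'n bifamily"
  proof -
    obtain X :: "'n mps ^ 'n" where X: "X \<in> carrier FDiff0" "is_push X (phi (\<chi> i. mps_var i)) \<psi>"
      using \<psi> by (auto simp: mem_orbit_iff)
    have Y: "inv\<^bsub>FDiff0\<^esub> X \<in> carrier FDiff0" using X by simp
    from is_push_inverse[OF Y is_push_phi[OF Y]] have "is_push X (phi (\<chi> i. mps_var i)) (phi (inv\<^bsub>FDiff0\<^esub> X))"
      using X by simp
    with X have "\<psi> = phi (inv\<^bsub>FDiff0\<^esub> X)"
      using ex1_is_push by blast
    with Y show ?thesis by blast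
  qed
  ultimately show ?thesis by blast
qed

lemma series_of_in_FDiff0:
  assumes "det A \<noteq> 0"
  shows "series_of A f \<in> carrier FDiff0"
proof -
  have eq: "series_of A f $ i = linear_series A $ i + Abs_mps (\<lambda>k. if mdeg k > 1 then f i k else 0)" for i
    by (simp add: series_of_def linear_series_def)
  have A: "invertible A" using assms by (simp add: invertible_det_nz)
  have "linear_part (series_of A f) = linear_part (linear_series A)"
    by (simp add: vec_eq_iff linear_part_def eq)
  with A no_constI_FDiff0[OF linear_series_in_FDiff0(1)[OF A]] show ?thesis
    by (simp add: FDiff0_def linear_series_in_FDiff0(2) no_const_def eq)
qed

lemma mps_polynomial_phi_id: "mps_polynomial (phi (\<chi> i. mps_var i) $ i $ j)"
proof -
  have "{k. mps_coeff (phi (\<chi> i. mps_var i) $ i $ j) k \<noteq> 0} \<subseteq>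
      {Poly_Mapping.single (Inl i) 1, Poly_Mapping.single (Inr j) 1}"
    by (auto simp: phi_id var_u_def var_v_def mps_coeff_var split: if_splits)
  then show ?thesis
    unfolding mps_polynomial_def by (rule finite_subset) simp
qed

theorem theorem6p2:
  shows "\<exists>\<O> \<in> orbits (FDiff0 :: ('n::finite mps ^ 'n) monoid) (Collect CYBE_solution) push_forward.
    \<O> \<subseteq> Collect CYBE_solution \<and>
    \<O> \<subseteq> of_type_phi \<and>
    (\<forall>A f. det A \<noteq> 0 \<longrightarrow> phi (series_of A f) \<in> \<O>) \<and>
    (\<forall>\<O>' \<in> orbits FDiff0 (Collect CYBE_solution) push_forward.
       (\<exists>A f. det A \<noteq> 0 \<and> phi (series_of A f) \<in> \<O>') \<longrightarrow> \<O>' = \<O>) \<and>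
    (let r = phi (\<chi> i. mps_var i) in r \<in> \<O> \<and> (\<forall>i j. mps_polynomial (r $ i $ j)))"
proof -
  interpret group "FDiff0 :: ('n mps ^ 'n) monoid" by (rule group_FDiff0)
  let ?r = "phi (\<chi> i. mps_var i) :: 'n bifamily"
  let ?O = "phi ` (carrier FDiff0 :: ('n mps ^ 'n) set)"
  have O: "orbit FDiff0 push_forward ?r = ?O" by (rule orbit_phi_id)
  have r: "?r \<in> ?O"
    using one_closed by (simp add: FDiff0_one)
  have CYBE: "?O \<subseteq> Collect CYBE_solution"
    using CYBE_solution_phi invertible_mps_jacobian by blast
  have type: "?O \<subseteq> of_type_phi"
    using invertible_mps_jacobian by (auto simp: of_type_phi_def)
  have orb: "?O \<in> orbits FDiff0 (Collect CYBE_solution) push_forward"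
    using r CYBE unfolding orbits_def O[symmetric] by blast
  have series: "\<forall>A f. det A \<noteq> 0 \<longrightarrow> phi (series_of A f) \<in> ?O"
    using series_of_in_FDiff0 by blast
  have unique: "\<O>' = ?O" if \<O>': "\<O>' \<in> orbits FDiff0 (Collect CYBE_solution) push_forward"
    and A: "det A \<noteq> 0" "phi (series_of A f) \<in> \<O>'" for \<O>' and A :: "real ^ 'n ^ 'n" and f
  proof -
    obtain \<psi> where \<psi>: "\<O>' = orbit FDiff0 push_forward \<psi>"
      using \<O>' unfolding orbits_def by blast
    then show ?thesis
      using orbit_eqI_FDiff0[of "phi (series_of A f)" \<psi>] orbit_eqI_FDiff0[of "phi (series_of A f)" ?r]
        A series O by auto
  qed
  show ?thesis
    unfolding Let_def by (rule bexI[OF _ orb]) (use CYBE type series unique r mps_polynomial_phi_id in blast)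
qed

end
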